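(* There exists an absolute constant $A > 0$ such that the following holds. Let $G = \mathbb{F}_2^n$ for some $n$, let $r$ be a positive integer, and suppose that $\alpha \colon G^4 \to \mathbb{F}_2$ is a multilinear form such that: (1) $\alpha$ is symmetric in the first 3 variables; (2) $\alpha(u,u,x_3,x_4) = 0$ for all $u, x_3, x_4 \in G$; (3) $\operatorname{prank}(\alpha + \alpha\circ(3\,\,4)) \leq r$. Then there exists a symmetric multilinear form $\alpha' \colon G^4 \to \mathbb{F}_2$ such that $\operatorname{prank}(\alpha + \alpha') \leq \exp(\exp(Ar))$.
   Context: For a multilinear form $\alpha \colon G^4 \to \mathbb{F}_2$, $\alpha\circ(3\,\,4)$ is the form $(x_1,x_2,x_3,x_4)\mapsto\alpha(x_1,x_2,x_4,x_3)$. A form is symmetric in a set of variables if it is invariant under all permutations of those variables, and symmetric if this holds for the set of all its variables. The partition rank $\operatorname{prank}\alpha$ of a multilinear form $\alpha \colon G^k \to \mathbb{F}_2$ is the least non-negative integer $m$ such that \[\alpha(x_1,\dots,x_k) = \sum_{i=1}^m \beta_i(x_j : j \in I_i)\,\gamma_i(x_j : j \in [k]\setminus I_i)\] for some sets $\emptyset \neq I_i \subsetneq [k]$ and multilinear forms $\beta_i \colon G^{I_i} \to \mathbb{F}_2$, $\gamma_i \colon G^{[k]\setminus I_i} \to \mathbb{F}_2$. *)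

theory Defs
  imports
    Complex_Main
    "HOL-Library.Z2"
    "HOL-Library.FuncSet"
    "HOL-Combinatorics.Permutations"
    "Jordan_Normal_Form.Matrix"
begin

text \<open>The field with two elements is the type \<^typ>\<open>bit\<close>, and \<open>G = F_2^n\<close> is
  \<open>carrier_vec n :: bit vec set\<close>. A point of \<open>G^I\<close> is a family of vectors indexed by \<open>I\<close>.\<close>

definition tuples :: "nat \<Rightarrow> nat set \<Rightarrow> (nat \<Rightarrow> bit vec) set" where
  "tuples n I = (I \<rightarrow>\<^sub>E carrier_vec n)"

text \<open>A form on \<open>G^I\<close> is a function on all families; only its values on \<^term>\<open>tuples n I\<close>
  matter, here and in all definitions below.\<close>

definition multilinear_form :: "nat \<Rightarrow> nat set \<Rightarrow> ((nat \<Rightarrow> bit vec) \<Rightarrow> bit) \<Rightarrow> bool" where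
  "multilinear_form n I \<alpha> \<longleftrightarrow>
     (\<forall>x\<in>tuples n I. \<forall>i\<in>I.
        (\<forall>u\<in>carrier_vec n. \<forall>v\<in>carrier_vec n.
           \<alpha> (x(i := u + v)) = \<alpha> (x(i := u)) + \<alpha> (x(i := v))) \<and>
        (\<forall>c. \<forall>v\<in>carrier_vec n. \<alpha> (x(i := c \<cdot>\<^sub>v v)) = c * \<alpha> (x(i := v))))"

definition permute_form ::
    "(nat \<Rightarrow> nat) \<Rightarrow> ((nat \<Rightarrow> bit vec) \<Rightarrow> bit) \<Rightarrow> (nat \<Rightarrow> bit vec) \<Rightarrow> bit" where
  "permute_form \<pi> \<alpha> = (\<lambda>x. \<alpha> (x \<circ> \<pi>))"

definition symmetric_in :: "nat \<Rightarrow> nat \<Rightarrow> nat set \<Rightarrow> ((nat \<Rightarrow> bit vec) \<Rightarrow> bit) \<Rightarrow> bool" where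
  "symmetric_in n k S \<alpha> \<longleftrightarrow>
     (\<forall>\<pi>. \<pi> permutes S \<longrightarrow> (\<forall>x\<in>tuples n {1..k}. permute_form \<pi> \<alpha> x = \<alpha> x))"

definition symmetric_form :: "nat \<Rightarrow> nat \<Rightarrow> ((nat \<Rightarrow> bit vec) \<Rightarrow> bit) \<Rightarrow> bool" where
  "symmetric_form n k \<alpha> \<longleftrightarrow> symmetric_in n k {1..k} \<alpha>"

definition partition_decomposition ::
    "nat \<Rightarrow> nat \<Rightarrow> ((nat \<Rightarrow> bit vec) \<Rightarrow> bit) \<Rightarrow> nat \<Rightarrow> bool" where
  "partition_decomposition n k \<alpha> m \<longleftrightarrow>
     (\<exists>I \<beta> \<gamma>.
        (\<forall>i\<in>{1..m}. I i \<noteq> {} \<and> I i \<subset> {1..k} \<and>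
           multilinear_form n (I i) (\<beta> i) \<and> multilinear_form n ({1..k} - I i) (\<gamma> i)) \<and>
        (\<forall>x\<in>tuples n {1..k}.
           \<alpha> x = (\<Sum>i = 1..m. \<beta> i (restrict x (I i)) * \<gamma> i (restrict x ({1..k} - I i)))))"

text \<open>The minimum exists for every multilinear form when \<open>k \<ge> 2\<close>, as shown below.\<close>

definition prank :: "nat \<Rightarrow> nat \<Rightarrow> ((nat \<Rightarrow> bit vec) \<Rightarrow> bit) \<Rightarrow> nat" where
  "prank n k \<alpha> = (LEAST m. partition_decomposition n k \<alpha> m)"

lemma tuples_upd: "x \<in> tuples n I \<Longrightarrow> i \<in> I \<Longrightarrow> v \<in> carrier_vec n \<Longrightarrow> x(i := v) \<in> tuples n I"
  by (auto simp: tuples_def PiE_iff extensional_def)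

lemma linear_expand_unit_vec:
  fixes f :: "'a::comm_ring_1 vec \<Rightarrow> 'a"
  assumes add: "\<And>u v. u \<in> carrier_vec n \<Longrightarrow> v \<in> carrier_vec n \<Longrightarrow> f (u + v) = f u + f v"
    and smult: "\<And>c v. v \<in> carrier_vec n \<Longrightarrow> f (c \<cdot>\<^sub>v v) = c * f v"
    and w: "w \<in> carrier_vec n"
  shows "f w = (\<Sum>j<n. w $ j * f (unit_vec n j))"
proof -
  define p where "p m = vec n (\<lambda>j. if j < m then w $ j else 0)" for m
  have "m \<le> n \<Longrightarrow> f (p m) = (\<Sum>j<m. w $ j * f (unit_vec n j))" for m
  proof (induction m)
    case 0
    have "p 0 = 0 \<cdot>\<^sub>v w"
      using w by (auto simp: p_def)
    then show ?case
      using smult[OF w, of 0] by simp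
  next
    case (Suc m)
    have "p (Suc m) = p m + (w $ m) \<cdot>\<^sub>v unit_vec n m"
      using Suc.prems by (intro eq_vecI) (auto simp: p_def less_Suc_eq)
    moreover have "p m \<in> carrier_vec n"
      by (simp add: p_def)
    ultimately show ?case
      using Suc add smult by simp
  qed
  moreover have "p n = w"
    using w by (intro eq_vecI) (auto simp: p_def)
  ultimately show ?thesis
    by (metis order_refl)
qed

lemma multilinear_form_expand:
  assumes ml: "multilinear_form n I \<alpha>" and x: "x \<in> tuples n I" and i: "i \<in> I"
  shows "\<alpha> x = (\<Sum>j<n. x i $ j * \<alpha> (x(i := unit_vec n j)))"
proof -
  have "x i \<in> carrier_vec n"
    using x i by (auto simp: tuples_def)
  then have "\<alpha> (x(i := x i)) = (\<Sum>j<n. x i $ j * \<alpha> (x(i := unit_vec n j)))"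
    using ml x i unfolding multilinear_form_def
    by (intro linear_expand_unit_vec[where f = "\<lambda>v. \<alpha> (x(i := v))"]) blast+
  then show ?thesis
    by (simp only: fun_upd_triv)
qed

lemma restrict_remove_upd:
  assumes "x \<in> extensional S" "a \<in> S"
  shows "(restrict x (S - {a}))(a := v) = x(a := v)"
  using assms by (auto simp: extensional_def fun_eq_iff)

lemma partition_decomposition_exists:
  assumes "2 \<le> k" and ml: "multilinear_form n {1..k} \<alpha>"
  shows "\<exists>m. partition_decomposition n k \<alpha> m"
proof -
  let ?e = "\<lambda>j. unit_vec n (j - 1) :: bit vec"
  define \<beta> where "\<beta> j y = y 1 $ (j - 1)" for j and y :: "nat \<Rightarrow> bit vec"
  define \<gamma> where "\<gamma> j y = \<alpha> (y(1 := ?e j))" for j y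
  have one: "1 \<in> {1..k}"
    using assms(1) by simp
  have b: "multilinear_form n {1} (\<beta> j)" if "j \<in> {1..n}" for j
    unfolding multilinear_form_def
  proof (intro ballI conjI allI)
    fix i and u v :: "bit vec" and x :: "nat \<Rightarrow> bit vec" and c :: bit
    assume i: "i \<in> {1::nat}" and v: "v \<in> carrier_vec n"
    have j: "j - 1 < dim_vec v"
      using that v by auto
    show "\<beta> j (x(i := c \<cdot>\<^sub>v v)) = c * \<beta> j (x(i := v))"
      using i index_smult_vec(1)[OF j] unfolding \<beta>_def by (simp only: singleton_iff fun_upd_same)
    show "\<beta> j (x(i := u + v)) = \<beta> j (x(i := u)) + \<beta> j (x(i := v))"
      using i index_add_vec(1)[OF j] unfolding \<beta>_def by (simp only: singleton_iff fun_upd_same)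
  qed
  have ext: "y(1 := ?e j) \<in> tuples n {1..k}" if "y \<in> tuples n ({1..k} - {1})" for y j
    using PiE_fun_upd[OF unit_vec_carrier[of n "j - 1"] that[unfolded tuples_def], of 1]
    unfolding tuples_def insert_Diff[OF one] .
  have g: "multilinear_form n ({1..k} - {1}) (\<gamma> j)" for j
    unfolding multilinear_form_def
  proof (intro ballI)
    fix y i assume y: "y \<in> tuples n ({1..k} - {1})" and i: "i \<in> {1..k} - {1}"
    have tw: "(y(i := v))(1 := ?e j) = (y(1 := ?e j))(i := v)" for v
      using i by (intro fun_upd_twist) blast
    show "(\<forall>u\<in>carrier_vec n. \<forall>v\<in>carrier_vec n.
          \<gamma> j (y(i := u + v)) = \<gamma> j (y(i := u)) + \<gamma> j (y(i := v))) \<and>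
        (\<forall>c. \<forall>v\<in>carrier_vec n. \<gamma> j (y(i := c \<cdot>\<^sub>v v)) = c * \<gamma> j (y(i := v)))"
      using ml ext[OF y, of j] i unfolding \<gamma>_def tw multilinear_form_def by blast
  qed
  have "\<alpha> x = (\<Sum>j = 1..n. \<beta> j (restrict x {1}) * \<gamma> j (restrict x ({1..k} - {1})))"
    if x: "x \<in> tuples n {1..k}" for x
  proof -
    have r: "(restrict x ({1..k} - {1}))(1 := v) = x(1 := v)" for v
      using x one unfolding tuples_def by (intro restrict_remove_upd) (simp_all only: PiE_iff)
    have "(\<Sum>j = 1..n. \<beta> j (restrict x {1}) * \<gamma> j (restrict x ({1..k} - {1})))
        = (\<Sum>j = 1..n. x 1 $ (j - 1) * \<alpha> (x(1 := ?e j)))"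
      unfolding \<beta>_def \<gamma>_def r by (simp only: restrict_apply singleton_iff if_True refl)
    also have "\<dots> = (\<Sum>j<n. x 1 $ j * \<alpha> (x(1 := unit_vec n j)))"
      by (rule sum.reindex_bij_witness[of _ Suc "\<lambda>j. j - 1"]) auto
    also have "\<dots> = \<alpha> x"
      using multilinear_form_expand[OF ml x one] by (rule sym)
    finally show ?thesis
      by (rule sym)
  qed
  moreover have "{1::nat} \<subset> {1..k}"
    using assms(1) by (auto simp: psubset_eq set_eq_iff intro!: exI[of _ k])
  ultimately have "partition_decomposition n k \<alpha> n"
    unfolding partition_decomposition_def using b g
    by (intro exI[of _ "\<lambda>_. {1}"] exI[of _ \<beta>] exI[of _ \<gamma>] conjI ballI insert_not_empty)
  then show ?thesis ..
qed

end

theory Submission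
  imports Defs "HOL-Library.Function_Algebras"
begin

text \<open>
  Write \<open>\<rho> = \<alpha> + \<alpha> \<circ> (3 4)\<close>. Pulling everything back along an endomorphism \<open>\<pi>\<close> of \<open>G\<close> for which
  \<open>\<pi> - 1\<close> has small rank changes \<open>\<alpha>\<close> only by small partition rank, and such a pullback can kill
  prescribed linear forms. So the terms of \<open>\<rho>\<close> with a linear factor disappear, and
  \<open>\<rho> = C(12|34) + D(13|24) + E(14|23)\<close> with \<open>C\<close>, \<open>D\<close>, \<open>E\<close> in \<open>B \<otimes> B\<close>, where \<open>B\<close> is a space of
  bilinear forms of dimension at most \<open>4r\<close>, closed under transposition. Further pullbacks make \<open>B\<close>
  regular: no nonzero form in \<open>B\<close> dies under a pullback with \<open>\<pi> - 1\<close> of rank at most \<open>4r\<close>. Then such a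
  representation is unique, since for fixed \<open>x\<^sub>1\<close>, \<open>x\<^sub>2\<close> the terms of the other two pairings are killed by
  few linear conditions. The symmetries of \<open>\<rho>\<close> therefore hold for \<open>C\<close>, \<open>D\<close>, \<open>E\<close> themselves: \<open>E = D\<close>, \<open>D\<close> is
  invariant under exchanging its two tensor factors, \<open>C\<close> is \<open>D\<close> plus its transpose in the second
  factor, and the four transposes of \<open>D\<close> sum to zero.

  Let \<open>K\<close> be the space of symmetric forms in \<open>B\<close>, and extend a basis of \<open>K\<close> to a basis \<open>b\<^sub>i\<close> of \<open>B\<close>. In
  \<open>D = \<Sum> d\<^sub>i\<^sub>j b\<^sub>i \<otimes> b\<^sub>j\<close> the matrix \<open>d\<close> is symmetric and vanishes when neither index belongs to \<open>K\<close>. Its diagonal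
  also vanishes: the alternating hypothesis gives \<open>\<rho>(x, y, x, y) = 0\<close>, which reads
  \<open>\<Sum> d\<^sub>i\<^sub>i b\<^sub>i(x, y) = D(x, x, y, y)\<close>, and the right side dies under a pullback of this kind. Hence
  \<open>D\<close> is \<open>F\<close> plus its exchange for some \<open>F \<in> K \<otimes> B\<close>, and adding \<open>F(12|34) + F(13|24) + F(23|14)\<close> makes \<open>\<alpha>\<close> symmetric.
  The resulting bound is quadratic in \<open>r\<close>.
\<close>

text \<open>As simp rules, these two equations destroy the ring structure of \<^typ>\<open>bit\<close>.\<close>

declare add_bit_eq_xor [simp del] mult_bit_eq_and [simp del]

section \<open>Vector spaces over the field with two elements\<close>

text \<open>An abelian group of exponent two is the same thing as a vector space over the field with
  two elements, and additive maps between such groups are automatically linear. Scalars enter only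
  through \<open>bscale\<close>, which makes span and independence available.\<close>

class boolean_group = ab_group_add +
  assumes add_self [simp]: "x + x = 0"
begin

lemma add_self_left [simp]: "x + (x + y) = y"
  by (simp flip: add.assoc)

lemma add_eq_0_iff_eq: "x + y = 0 \<longleftrightarrow> x = y"
  by (metis add_self add_self_left add_0_right)

end

instance bit :: boolean_group
  by standard (metis (full_types) add.right_neutral bit_2_eq_0 mult_2 mult_zero_left)

instance "fun" :: (type, boolean_group) boolean_group
  by standard (simp add: fun_eq_iff)

definition bscale :: "bit \<Rightarrow> 'v::boolean_group \<Rightarrow> 'v" where
  "bscale c x = (if c = 0 then 0 else x)"

lemma bscale_bit [simp]: "bscale c x = c * x" for x :: bit
  by (simp add: bscale_def)

lemma bscale_fun: "bscale c f x = bscale c (f x)"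
  by (simp add: bscale_def)

lemma bscale_0 [simp]: "bscale 0 x = 0" "bscale c 0 = 0" and bscale_1 [simp]: "bscale 1 x = x"
  by (simp_all add: bscale_def)

lemma bscale_add_left: "bscale (c + d) x = bscale c x + bscale d x"
  by (cases c; cases d) simp_all

interpretation bv: vector_space "bscale :: bit \<Rightarrow> 'v::boolean_group \<Rightarrow> 'v"
proof
  fix a b :: bit and x y :: 'v
  show "bscale a (x + y) = bscale a x + bscale a y" "bscale (a + b) x = bscale a x + bscale b x"
    "bscale a (bscale b x) = bscale (a * b) x" "bscale 1 x = x"
    by (simp_all add: bscale_add_left) (simp_all add: bscale_def)
qed

lemma additive_bscale: "additive f \<Longrightarrow> f (bscale c x) = bscale c (f x)"
  by (simp add: bscale_def additive.zero)

section \<open>Pullbacks close to the identity, and partition rank\<close>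

text \<open>These are the maps whose difference from the identity has rank at most \<open>c\<close>,
  built by one rank-one update at a time so that the cost of a pullback can be counted per
  update.\<close>

inductive near_id :: "nat \<Rightarrow> ('v::boolean_group \<Rightarrow> 'v) \<Rightarrow> bool" where
  near_id_0: "near_id 0 (\<lambda>x. x)"
| near_id_Suc: "near_id c \<pi> \<Longrightarrow> additive \<mu> \<Longrightarrow> near_id (Suc c) (\<lambda>x. \<pi> x + bscale (\<mu> x) e)"

lemma near_id_additive: "near_id c \<pi> \<Longrightarrow> additive \<pi>"
  by (induction rule: near_id.induct)
    (simp_all add: additive_def bscale_add_left algebra_simps)

text \<open>Ranks add because \<open>\<pi> \<circ> \<sigma> - 1 = (\<pi> - 1) \<circ> \<sigma> +
  (\<sigma> - 1)\<close>: each functional \<open>\<mu>\<close> occurring in \<open>\<pi>\<close>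
  becomes \<open>\<mu> \<circ> \<sigma>\<close>.\<close>

lemma near_id_compose:
  assumes "near_id c \<pi>" "near_id d \<sigma>"
  shows "near_id (c + d) (\<lambda>x. \<pi> (\<sigma> x))"
  using assms(1)
proof induction
  case near_id_0
  then show ?case using assms(2) by simp
next
  case (near_id_Suc c \<pi> \<mu> e)
  have "additive (\<lambda>x. \<mu> (\<sigma> x))"
    using near_id_Suc.hyps near_id_additive[OF assms(2)] by (simp add: additive_def)
  from near_id.near_id_Suc[OF near_id_Suc.IH this] show ?case by simp
qed

lemma near_id_mono: "near_id c \<pi> \<Longrightarrow> c \<le> d \<Longrightarrow> near_id d \<pi>"
proof (induction d)
  case (Suc d)
  show ?case
  proof (cases "c = Suc d")
    case False
    then have "near_id (Suc d) (\<lambda>x. \<pi> x + bscale 0 0)"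
      using Suc by (intro near_id.near_id_Suc) (simp_all add: additive_def)
    then show ?thesis by simp
  qed (use Suc.prems in simp)
qed simp

lemma near_id_annihilating:
  fixes ls :: "('v::boolean_group \<Rightarrow> bit) list"
  assumes "\<And>l. l \<in> set ls \<Longrightarrow> additive l" "length ls \<le> c"
  shows "\<exists>\<pi>. near_id c \<pi> \<and> (\<forall>l\<in>set ls. \<forall>x. l (\<pi> x) = 0)"
proof -
  have "\<exists>\<pi>. near_id (length ls) \<pi> \<and> (\<forall>l\<in>set ls. \<forall>x. l (\<pi> x) = 0)"
    using assms(1)
  proof (induction ls)
    case Nil
    then show ?case using near_id_0 by auto
  next
    case (Cons m ls)
    then obtain \<pi> where \<pi>: "near_id (length ls) \<pi>" "\<And>l x. l \<in> set ls \<Longrightarrow> l (\<pi> x) = 0"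
      by auto
    show ?case
    proof (cases "\<forall>x. m (\<pi> x) = 0")
      case True
      then show ?thesis using \<pi> near_id_mono[OF \<pi>(1), of "Suc (length ls)"] by auto
    next
      case False
      then obtain e where e: "m (\<pi> e) = 1" by auto
      \<comment> \<open>Follow \<open>\<pi>\<close> by the projection along \<open>\<pi> e\<close>
        onto the kernel of \<open>m\<close>. The earlier functionals vanish at
        \<open>\<pi> e\<close>, so they stay annihilated.\<close>
      define \<sigma> where "\<sigma> x = \<pi> x + bscale (m (\<pi> x)) (\<pi> e)" for x
      have add: "l (u + v) = l u + l v" if "l \<in> set (m # ls)" for l u v
        using Cons.prems[OF that] by (simp add: additive_def)
      have ml: "additive (\<lambda>x. m (\<pi> x))"
        using add near_id_additive[OF \<pi>(1)] by (simp add: additive_def)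
      have "near_id (Suc (length ls)) \<sigma>"
        unfolding \<sigma>_def using \<pi>(1) ml by (rule near_id.near_id_Suc)
      moreover have "l (\<sigma> x) = 0" if "l \<in> set (m # ls)" for l x
        using that e by (auto simp: \<sigma>_def add additive_bscale Cons.prems \<pi>(2))
      ultimately show ?thesis by auto
    qed
  qed
  then show ?thesis using near_id_mono assms(2) by blast
qed

section \<open>Forms in four variables and their partition rank\<close>

definition varies_in :: "bool \<Rightarrow> ('v::boolean_group \<Rightarrow> bit) \<Rightarrow> bool" where
  "varies_in p f \<longleftrightarrow> (if p then additive f else (\<forall>x y. f x = f y))"

type_synonym 'v form = "'v \<Rightarrow> 'v \<Rightarrow> 'v \<Rightarrow> 'v \<Rightarrow> bit"

text \<open>A form on \<open>G^I\<close> is encoded as a function of all four arguments that is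
  constant in those outside \<open>I\<close>, so that forms on different index sets can be
  multiplied pointwise.\<close>

definition form_on :: "nat set \<Rightarrow> 'v::boolean_group form \<Rightarrow> bool" where
  "form_on I f \<longleftrightarrow> (\<forall>x y z w. varies_in (1 \<in> I) (\<lambda>x. f x y z w) \<and> varies_in (2 \<in> I) (\<lambda>y. f x y z w)
      \<and> varies_in (3 \<in> I) (\<lambda>z. f x y z w) \<and> varies_in (4 \<in> I) (\<lambda>w. f x y z w))"

abbreviation quadrilinear :: "'v::boolean_group form \<Rightarrow> bool" where
  "quadrilinear \<equiv> form_on {1..4}"

inductive partition_sum :: "nat \<Rightarrow> 'v::boolean_group form \<Rightarrow> bool" where
  partition_sum_0: "partition_sum 0 (\<lambda>_ _ _ _. 0)"
| partition_sum_Suc: "partition_sum m f \<Longrightarrow> i \<in> I \<Longrightarrow> j \<in> {1..4} - I \<Longrightarrow> I \<subseteq> {1..4} \<Longrightarrow> form_on I b \<Longrightarrow>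
    form_on ({1..4} - I) c \<Longrightarrow> partition_sum (Suc m) (\<lambda>x y z w. f x y z w + b x y z w * c x y z w)"

lemma partition_sum_add:
  assumes "partition_sum m f" "partition_sum k g"
  shows "partition_sum (m + k) (\<lambda>x y z w. f x y z w + g x y z w)"
  using assms(2)
proof induction
  case partition_sum_0
  then show ?case using assms(1) by simp
next
  case (partition_sum_Suc k g i I j b c)
  from partition_sum.partition_sum_Suc[OF partition_sum_Suc.IH partition_sum_Suc.hyps(2-6)]
  show ?case by (simp add: add.assoc)
qed

lemma partition_sum_mono:
  assumes "partition_sum m f" "m \<le> k"
  shows "partition_sum k f"
proof -
  have "partition_sum (m + d) f" for d
  proof (induction d)
    case (Suc d)
    have "partition_sum (Suc (m + d)) (\<lambda>x y z w. f x y z w + 0 * 0)"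
      by (rule partition_sum_Suc[OF Suc.IH, of 1 "{1}" 2]) (simp_all add: form_on_def varies_in_def additive_def)
    then show ?case by simp
  qed (use assms in simp)
  from this[of "k - m"] show ?thesis using assms(2) by simp
qed

lemma quadrilinear_iff: "quadrilinear f \<longleftrightarrow> (\<forall>x x' y z w. f (x + x') y z w = f x y z w + f x' y z w) \<and>
    (\<forall>x y y' z w. f x (y + y') z w = f x y z w + f x y' z w) \<and>
    (\<forall>x y z z' w. f x y (z + z') w = f x y z w + f x y z' w) \<and>
    (\<forall>x y z w w'. f x y z (w + w') = f x y z w + f x y z w')"
  by (auto simp: form_on_def varies_in_def additive_def)

text \<open>After a rank-one update of \<open>\<pi>\<close>, the four arguments are switched to the
  new map one after the other. Each switch adds the linear form \<open>\<mu>\<close> in one variable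
  times a form in the other three, so an update costs four terms.\<close>

lemma partition_sum_near_id:
  assumes "quadrilinear f" "near_id c \<pi>"
  shows "partition_sum (4 * c) (\<lambda>x y z w. f x y z w + f (\<pi> x) (\<pi> y) (\<pi> z) (\<pi> w))"
  using assms(2)
proof induction
  case near_id_0
  then show ?case using partition_sum_0 by simp
next
  case (near_id_Suc c \<pi> \<mu> e)
  note add = assms(1)[unfolded quadrilinear_iff]
  have z: "f 0 y z w = 0" "f x 0 z w = 0" "f x y 0 w = 0" "f x y z 0 = 0" for x y z w
    using add by (metis add_self)+
  have sc: "f (bscale a x) y z w = a * f x y z w" "f x (bscale a y) z w = a * f x y z w"
    "f x y (bscale a z) w = a * f x y z w" "f x y z (bscale a w) = a * f x y z w" for a x y z w
    by (cases a; simp add: z)+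
  note mu = near_id_Suc.hyps(2)[unfolded additive_def]
  note pi = near_id_additive[OF near_id_Suc.hyps(1), unfolded additive_def]
  define \<sigma> where "\<sigma> = (\<lambda>x. \<pi> x + bscale (\<mu> x) e)"
  have "near_id (Suc c) \<sigma>"
    unfolding \<sigma>_def using near_id_Suc.hyps by (rule near_id.near_id_Suc)
  then have si: "\<forall>x y. \<sigma> (x + y) = \<sigma> x + \<sigma> y"
    using near_id_additive by (auto simp: additive_def)
  note step = partition_sum.partition_sum_Suc
  have "partition_sum (Suc (Suc (Suc (Suc (4 * c))))) (\<lambda>x y z w.
      f x y z w + f (\<pi> x) (\<pi> y) (\<pi> z) (\<pi> w) + \<mu> x * f e (\<pi> y) (\<pi> z) (\<pi> w)
        + \<mu> y * f (\<sigma> x) e (\<pi> z) (\<pi> w) + \<mu> z * f (\<sigma> x) (\<sigma> y) e (\<pi> w)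
        + \<mu> w * f (\<sigma> x) (\<sigma> y) (\<sigma> z) e)"
    by (intro step[where i = 4 and I = "{4}" and j = 1] step[where i = 3 and I = "{3}" and j = 1]
        step[where i = 2 and I = "{2}" and j = 1] step[where i = 1 and I = "{1}" and j = 2] near_id_Suc.IH)
      (simp_all add: form_on_def varies_in_def additive_def add mu pi si)
  moreover have "f (\<sigma> x) (\<sigma> y) (\<sigma> z) (\<sigma> w) = f (\<pi> x) (\<pi> y) (\<pi> z) (\<pi> w) + \<mu> x * f e (\<pi> y) (\<pi> z) (\<pi> w)
        + \<mu> y * f (\<sigma> x) e (\<pi> z) (\<pi> w) + \<mu> z * f (\<sigma> x) (\<sigma> y) e (\<pi> w)
        + \<mu> w * f (\<sigma> x) (\<sigma> y) (\<sigma> z) e" for x y z w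
  proof -
    have "f (\<sigma> x) (\<sigma> y) (\<sigma> z) (\<sigma> w) = f (\<sigma> x) (\<sigma> y) (\<sigma> z) (\<pi> w) + \<mu> w * f (\<sigma> x) (\<sigma> y) (\<sigma> z) e"
      by (subst (4) \<sigma>_def) (simp add: add sc)
    also have "f (\<sigma> x) (\<sigma> y) (\<sigma> z) (\<pi> w) = f (\<sigma> x) (\<sigma> y) (\<pi> z) (\<pi> w) + \<mu> z * f (\<sigma> x) (\<sigma> y) e (\<pi> w)"
      by (subst (3) \<sigma>_def) (simp add: add sc)
    also have "f (\<sigma> x) (\<sigma> y) (\<pi> z) (\<pi> w) = f (\<sigma> x) (\<pi> y) (\<pi> z) (\<pi> w) + \<mu> y * f (\<sigma> x) e (\<pi> z) (\<pi> w)"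
      by (subst (2) \<sigma>_def) (simp add: add sc)
    also have "f (\<sigma> x) (\<pi> y) (\<pi> z) (\<pi> w) = f (\<pi> x) (\<pi> y) (\<pi> z) (\<pi> w) + \<mu> x * f e (\<pi> y) (\<pi> z) (\<pi> w)"
      by (subst \<sigma>_def) (simp add: add sc)
    finally show ?thesis .
  qed
  ultimately have "partition_sum (Suc (Suc (Suc (Suc (4 * c))))) (\<lambda>x y z w.
      f x y z w + f (\<sigma> x) (\<sigma> y) (\<sigma> z) (\<sigma> w))"
    by (simp add: add.assoc)
  moreover have "4 * Suc c = Suc (Suc (Suc (Suc (4 * c))))"
    by simp
  ultimately show ?case unfolding \<sigma>_def by (simp only:)
qed

section \<open>Pairings of bilinear forms\<close>

definition bilinear :: "('v::boolean_group \<Rightarrow> 'v \<Rightarrow> bit) \<Rightarrow> bool" where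
  "bilinear b \<longleftrightarrow> (\<forall>y. additive (\<lambda>x. b x y)) \<and> (\<forall>x. additive (b x))"

definition pairing_sum :: "(('v \<Rightarrow> 'v \<Rightarrow> bit) \<times> ('v \<Rightarrow> 'v \<Rightarrow> bit)) list \<Rightarrow> 'v form" where
  "pairing_sum ps x y z w = (\<Sum>(b, c)\<leftarrow>ps. b x y * c z w)"

lemma pairing_sum_simps [simp]:
  "pairing_sum [] x y z w = 0"
  "pairing_sum ((b, c) # ps) x y z w = b x y * c z w + pairing_sum ps x y z w"
  "pairing_sum (ps @ qs) x y z w = pairing_sum ps x y z w + pairing_sum qs x y z w"
  by (simp_all add: pairing_sum_def)

lemma form_on_const:
  assumes "form_on I f"
  shows "1 \<notin> I \<Longrightarrow> f x y z w = f 0 y z w" "2 \<notin> I \<Longrightarrow> f x y z w = f x 0 z w"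
    "3 \<notin> I \<Longrightarrow> f x y z w = f x y 0 w" "4 \<notin> I \<Longrightarrow> f x y z w = f x y z 0"
  using assms unfolding form_on_def varies_in_def by metis+

lemma form_on_additive:
  assumes "form_on I f"
  shows "1 \<in> I \<Longrightarrow> additive (\<lambda>x. f x y z w)" "2 \<in> I \<Longrightarrow> additive (\<lambda>y. f x y z w)"
    "3 \<in> I \<Longrightarrow> additive (\<lambda>z. f x y z w)" "4 \<in> I \<Longrightarrow> additive (\<lambda>w. f x y z w)"
  using assms unfolding form_on_def varies_in_def by presburger+

text \<open>The variable carrying the linear factor is deliberately forgotten: a pullback acts on
  all four arguments at once, so it is enough that the term dies when \<open>l\<close> vanishes at
  all of them.\<close>

definition has_linear_factor :: "'v::boolean_group form \<Rightarrow> bool" where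
  "has_linear_factor f \<longleftrightarrow> (\<exists>l :: 'v::boolean_group \<Rightarrow> bit. additive l \<and>
     (\<forall>x y z w. l x = 0 \<longrightarrow> l y = 0 \<longrightarrow> l z = 0 \<longrightarrow> l w = 0 \<longrightarrow> f x y z w = 0))"

definition is_pairing :: "'v::boolean_group form \<Rightarrow> bool" where
  "is_pairing f \<longleftrightarrow> (\<exists>\<beta> \<gamma>. bilinear \<beta> \<and> bilinear \<gamma> \<and>
     ((\<forall>x y z w. f x y z w = \<beta> x y * \<gamma> z w) \<or> (\<forall>x y z w. f x y z w = \<beta> x z * \<gamma> y w) \<or>
      (\<forall>x y z w. f x y z w = \<beta> x w * \<gamma> y z)))"

lemma is_pairingI:
  assumes "bilinear \<beta>" "bilinear \<gamma>"
  shows "(\<And>x y z w. f x y z w = \<beta> x y * \<gamma> z w) \<Longrightarrow> is_pairing f"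
    "(\<And>x y z w. f x y z w = \<beta> x z * \<gamma> y w) \<Longrightarrow> is_pairing f"
    "(\<And>x y z w. f x y z w = \<beta> x w * \<gamma> y z) \<Longrightarrow> is_pairing f"
  using assms unfolding is_pairing_def by blast+

text \<open>If \<open>I\<close> has one or three elements, then \<open>b\<close> or \<open>c\<close>
  is linear in a single variable; if it has two, the product is one of the three pairings. The set
  \<open>J\<close> is a separate parameter so that \<open>b\<close> and \<open>c\<close> can be
  exchanged when the index 1 belongs to the other side.\<close>

lemma split_term_cases_aux:
  fixes b c :: "'v::boolean_group form"
  assumes b: "form_on I b" and c: "form_on J c" and J: "\<And>k. k \<in> {1..4} \<Longrightarrow> k \<in> J \<longleftrightarrow> k \<notin> I"
    and one: "1 \<in> I" and j: "2 \<in> J \<or> 3 \<in> J \<or> 4 \<in> J"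
  shows "has_linear_factor (\<lambda>x y z w. b x y z w * c x y z w) \<or> is_pairing (\<lambda>x y z w. b x y z w * c x y z w)"
proof -
  note bc = form_on_const[OF b] and cc = form_on_const[OF c]
  note ba = form_on_additive[OF b] and ca = form_on_additive[OF c]
  have J': "2 \<in> J \<longleftrightarrow> 2 \<notin> I" "3 \<in> J \<longleftrightarrow> 3 \<notin> I" "4 \<in> J \<longleftrightarrow> 4 \<notin> I" "1 \<notin> J"
    using J one by auto
  have lin: ?thesis if "additive l" "\<And>x y z w. b x y z w = l x \<or> c x y z w = l y \<or> c x y z w = l z \<or> c x y z w = l w" for l :: "'v \<Rightarrow> bit"
  proof -
    have "has_linear_factor (\<lambda>x y z w. b x y z w * c x y z w)"
      unfolding has_linear_factor_def using that by (intro exI[of _ l]) (metis mult_zero_left mult_zero_right)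
    then show ?thesis ..
  qed
  consider "2 \<notin> I" "3 \<notin> I" "4 \<notin> I" | "2 \<in> I" "3 \<notin> I" "4 \<notin> I" | "2 \<notin> I" "3 \<in> I" "4 \<notin> I"
    | "2 \<notin> I" "3 \<notin> I" "4 \<in> I" | "2 \<in> I" "3 \<in> I" "4 \<notin> I" | "2 \<in> I" "3 \<notin> I" "4 \<in> I" | "2 \<notin> I" "3 \<in> I" "4 \<in> I"
    using j J' by blast
  then show ?thesis
  proof cases
    case 1
    have "b x y z w = b x 0 0 0" for x y z w
      using bc(2-4) 1 by metis
    then show ?thesis using ba(1)[OF one] by (intro lin[of "\<lambda>x. b x 0 0 0"]) blast+
  next
    case 5
    have "c x y z w = c 0 0 0 w" for x y z w
      using cc(1-3) J' 5 by metis
    then show ?thesis using ca(4) J' 5 by (intro lin[of "\<lambda>w. c 0 0 0 w"]) blast+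
  next
    case 6
    have "c x y z w = c 0 0 z 0" for x y z w
      using cc(1,2,4) J' 6 by metis
    then show ?thesis using ca(3) J' 6 by (intro lin[of "\<lambda>z. c 0 0 z 0"]) blast+
  next
    case 7
    have "c x y z w = c 0 y 0 0" for x y z w
      using cc(1,3,4) J' 7 by metis
    then show ?thesis using ca(2) J' 7 by (intro lin[of "\<lambda>y. c 0 y 0 0"]) blast+
  next
    case 2
    have bc_eq: "b x y z w = b x y 0 0" "c x y z w = c 0 0 z w" for x y z w
      using bc(3,4) cc(1,2) J' 2 by metis+
    have "bilinear (\<lambda>x y. b x y 0 0)" "bilinear (\<lambda>z w. c 0 0 z w)"
      using ba(1,2) ca(3,4) J' one 2 by (simp_all add: bilinear_def)
    then have "is_pairing (\<lambda>x y z w. b x y z w * c x y z w)"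
    proof (rule is_pairingI(1))
      fix x y z w
      show "b x y z w * c x y z w = b x y 0 0 * c 0 0 z w"
        using bc_eq[of x y z w] by (simp only:)
    qed
    then show ?thesis ..
  next
    case 3
    have bc_eq: "b x y z w = b x 0 z 0" "c x y z w = c 0 y 0 w" for x y z w
      using bc(2,4) cc(1,3) J' 3 by metis+
    have "bilinear (\<lambda>x z. b x 0 z 0)" "bilinear (\<lambda>y w. c 0 y 0 w)"
      using ba(1,3) ca(2,4) J' one 3 by (simp_all add: bilinear_def)
    then have "is_pairing (\<lambda>x y z w. b x y z w * c x y z w)"
    proof (rule is_pairingI(2))
      fix x y z w
      show "b x y z w * c x y z w = b x 0 z 0 * c 0 y 0 w"
        using bc_eq[of x y z w] by (simp only:)
    qed
    then show ?thesis ..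
  next
    case 4
    have bc_eq: "b x y z w = b x 0 0 w" "c x y z w = c 0 y z 0" for x y z w
      using bc(2,3) cc(1,4) J' 4 by metis+
    have "bilinear (\<lambda>x w. b x 0 0 w)" "bilinear (\<lambda>y z. c 0 y z 0)"
      using ba(1,4) ca(2,3) J' one 4 by (simp_all add: bilinear_def)
    then have "is_pairing (\<lambda>x y z w. b x y z w * c x y z w)"
    proof (rule is_pairingI(3))
      fix x y z w
      show "b x y z w * c x y z w = b x 0 0 w * c 0 y z 0"
        using bc_eq[of x y z w] by (simp only:)
    qed
    then show ?thesis ..
  qed
qed

lemma split_term_cases:
  assumes I: "i \<in> I" "j \<in> {1..4} - I" "I \<subseteq> {1..4}" and b: "form_on I b" and c: "form_on ({1..4} - I) c"
  shows "has_linear_factor (\<lambda>x y z w. b x y z w * c x y z w) \<or> is_pairing (\<lambda>x y z w. b x y z w * c x y z w)"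
proof (cases "1 \<in> I")
  case True
  have "j = 1 \<or> j = 2 \<or> j = 3 \<or> j = 4"
    using I(2) by auto
  then have "2 \<in> {1..4} - I \<or> 3 \<in> {1..4} - I \<or> 4 \<in> {1..4} - I"
    using True I(2) by blast
  then show ?thesis
    using True by (intro split_term_cases_aux[OF b c]) simp_all
next
  case False
  have "i = 1 \<or> i = 2 \<or> i = 3 \<or> i = 4"
    using I(1,3) by auto
  then have "2 \<in> I \<or> 3 \<in> I \<or> 4 \<in> I"
    using False I(1) by blast
  then have "has_linear_factor (\<lambda>x y z w. c x y z w * b x y z w) \<or> is_pairing (\<lambda>x y z w. c x y z w * b x y z w)"
    using False by (intro split_term_cases_aux[OF c b]) simp_all
  then show ?thesis by (simp add: mult.commute)
qed

text \<open>The lists \<open>ps\<close>, \<open>qs\<close>, \<open>rs\<close> hold the pairings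
  12|34, 13|24 and 14|23. Terms with a linear factor survive only as their linear forms
  \<open>ls\<close>, and the identity is claimed on the common kernel of these.\<close>

definition pairing_decomposition where
  "pairing_decomposition m ls ps qs rs f \<longleftrightarrow>
     (\<forall>l :: 'v::boolean_group \<Rightarrow> bit \<in> set ls. additive l) \<and>
     length ls + length ps + length qs + length rs \<le> m \<and>
     set ps \<union> set qs \<union> set rs \<subseteq> Collect bilinear \<times> Collect bilinear \<and>
     (\<forall>x y z w. (\<forall>l\<in>set ls. l x = 0 \<and> l y = 0 \<and> l z = 0 \<and> l w = 0) \<longrightarrow>
       f x y z w = pairing_sum ps x y z w + pairing_sum qs x z y w + pairing_sum rs x w y z)"

lemma partition_sum_pairings:
  fixes f :: "'v::boolean_group form"
  shows "partition_sum m f \<Longrightarrow> \<exists>ls ps qs rs. pairing_decomposition m ls ps qs rs f"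
proof (induction rule: partition_sum.induct)
  case partition_sum_0
  have "pairing_decomposition 0 [] [] [] [] (\<lambda>_ _ _ _. 0)"
    by (simp add: pairing_decomposition_def)
  then show ?case by blast
next
  case (partition_sum_Suc m f i I j b c)
  obtain ls ps qs rs where IH: "pairing_decomposition m ls ps qs rs f"
    using partition_sum_Suc.IH by blast
  let ?g = "\<lambda>x y z w. f x y z w + b x y z w * c x y z w"
  from split_term_cases[OF partition_sum_Suc.hyps(2-6)] show ?case
  proof
    assume "has_linear_factor (\<lambda>x y z w. b x y z w * c x y z w)"
    then obtain l :: "'v \<Rightarrow> bit" where "additive l"
      "\<forall>x y z w. l x = 0 \<longrightarrow> l y = 0 \<longrightarrow> l z = 0 \<longrightarrow> l w = 0 \<longrightarrow> b x y z w * c x y z w = 0"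
      unfolding has_linear_factor_def by blast
    then have "pairing_decomposition (Suc m) (l # ls) ps qs rs ?g"
      using IH by (simp add: pairing_decomposition_def)
    then show ?thesis by blast
  next
    assume "is_pairing (\<lambda>x y z w. b x y z w * c x y z w)"
    then obtain \<beta> \<gamma> where bil: "bilinear \<beta>" "bilinear \<gamma>" and
      "(\<forall>x y z w. b x y z w * c x y z w = \<beta> x y * \<gamma> z w) \<or> (\<forall>x y z w. b x y z w * c x y z w = \<beta> x z * \<gamma> y w) \<or>
        (\<forall>x y z w. b x y z w * c x y z w = \<beta> x w * \<gamma> y z)"
      unfolding is_pairing_def by blast
    then have "pairing_decomposition (Suc m) ls ((\<beta>, \<gamma>) # ps) qs rs ?g \<or>
        pairing_decomposition (Suc m) ls ps ((\<beta>, \<gamma>) # qs) rs ?g \<or>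
        pairing_decomposition (Suc m) ls ps qs ((\<beta>, \<gamma>) # rs) ?g"
      using IH unfolding pairing_decomposition_def
      by (elim disjE) (simp_all add: bil algebra_simps)
    then show ?thesis by blast
  qed
qed

section \<open>Regular spaces of bilinear forms\<close>

definition pullback :: "('v \<Rightarrow> 'v) \<Rightarrow> ('v \<Rightarrow> 'v \<Rightarrow> bit) \<Rightarrow> 'v \<Rightarrow> 'v \<Rightarrow> bit" where
  "pullback \<pi> b = (\<lambda>x y. b (\<pi> x) (\<pi> y))"

lemma pullback_0 [simp]: "pullback \<pi> 0 = 0"
  by (simp add: pullback_def fun_eq_iff)

lemma pullback_span: "pullback \<pi> ` bv.span S = bv.span (pullback \<pi> ` S)"
proof -
  have "module_hom bscale bscale (pullback \<pi>)"
    unfolding module_hom_iff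
    by (intro conjI bv.module_axioms allI) (simp_all add: pullback_def fun_eq_iff bscale_fun)
  from module_hom.span_image[OF this, of S] show ?thesis by simp
qed

text \<open>This stands in for a lower bound on rank: a nonzero form of rank at most
  \<open>c\<close> would be killed by a map that annihilates its left linear factors.\<close>

definition regular :: "nat \<Rightarrow> ('v::boolean_group \<Rightarrow> 'v \<Rightarrow> bit) set \<Rightarrow> bool" where
  "regular c B \<longleftrightarrow> (\<forall>b\<in>B. \<forall>\<pi>. near_id c \<pi> \<longrightarrow> pullback \<pi> b = 0 \<longrightarrow> b = 0)"

text \<open>Steinitz exchange: add the generators one by one; the generator at which
  \<open>b\<close> first enters the span can be recovered from \<open>b\<close> and the previous
  ones.\<close>

lemma span_exchange:
  fixes S :: "'v::boolean_group set"
  assumes "finite S" "b \<in> bv.span S" "b \<noteq> 0"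
  shows "\<exists>g\<in>S. g \<in> bv.span (insert b (S - {g}))"
  using assms
proof induction
  case empty
  then show ?case by simp
next
  case (insert g S)
  show ?case
  proof (cases "b \<in> bv.span S")
    case True
    then obtain h where h: "h \<in> S" "h \<in> bv.span (insert b (S - {h}))"
      using insert by blast
    moreover have "bv.span (insert b (S - {h})) \<subseteq> bv.span (insert b (insert g S - {h}))"
      by (intro bv.span_mono) blast
    ultimately show ?thesis by blast
  next
    case False
    then have "g \<in> bv.span (insert b S)"
      using insert.prems bv.in_span_insert by blast
    then show ?thesis using insert.hyps by simp
  qed
qed

text \<open>If a nonzero \<open>b\<close> in the span dies under some pullback, then a generator
  that can be exchanged for \<open>b\<close> becomes redundant after that pullback. So each failure
  of regularity removes a generator at cost \<open>c\<close>, and this happens at most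
  \<open>card S\<close> times.\<close>

lemma regularize:
  fixes S :: "('v::boolean_group \<Rightarrow> 'v \<Rightarrow> bit) set"
  assumes "finite S"
  shows "\<exists>\<pi> T. near_id (card S * c) \<pi> \<and> finite T \<and> card T \<le> card S \<and>
    bv.span T = pullback \<pi> ` bv.span S \<and> regular c (bv.span T)"
  using assms
proof (induction "card S" arbitrary: S rule: less_induct)
  case less
  show ?case
  proof (cases "regular c (bv.span S)")
    case True
    have "near_id (card S * c) (\<lambda>x::'v. x)"
      using near_id_mono[OF near_id_0] by simp
    moreover have "pullback (\<lambda>x. x) ` bv.span S = bv.span S"
      by (simp add: pullback_def)
    ultimately show ?thesis using True less.prems by blast
  next
    case False
    then obtain b \<pi> where b: "b \<in> bv.span S" "b \<noteq> 0" "pullback \<pi> b = 0" "near_id c \<pi>"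
      unfolding regular_def by blast
    then obtain g where g: "g \<in> S" "g \<in> bv.span (insert b (S - {g}))"
      using span_exchange[OF less.prems] by blast
    define T where "T = pullback \<pi> ` (S - {g})"
    have "pullback \<pi> g \<in> bv.span (insert 0 T)"
      using imageI[OF g(2), of "pullback \<pi>"] b(3) by (simp add: pullback_span T_def)
    then have gT: "pullback \<pi> g \<in> bv.span T"
      by (simp add: bv.span_insert_0)
    have span: "pullback \<pi> ` bv.span S = bv.span T"
    proof -
      have "pullback \<pi> ` S = insert (pullback \<pi> g) T"
        using g(1) by (auto simp: T_def)
      then show ?thesis
        using bv.span_redundant[OF gT] by (simp add: pullback_span)
    qed
    have card: "card T < card S" and fin: "finite T"
      using less.prems g(1) card_image_le[of "S - {g}" "pullback \<pi>"] card_Diff1_less[of S g]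
      by (auto simp: T_def)
    from less.hyps[OF card fin] obtain \<sigma> T' where T': "near_id (card T * c) \<sigma>" "finite T'"
      "card T' \<le> card T" "bv.span T' = pullback \<sigma> ` bv.span T" "regular c (bv.span T')"
      by blast
    have "near_id (card S * c) (\<lambda>x. \<pi> (\<sigma> x))"
    proof (rule near_id_mono[OF near_id_compose[OF b(4) T'(1)]])
      have "Suc (card T) * c \<le> card S * c"
        using card by (intro mult_le_mono1) simp
      then show "c + card T * c \<le> card S * c" by simp
    qed
    moreover have "bv.span T' = pullback (\<lambda>x. \<pi> (\<sigma> x)) ` bv.span S"
      unfolding T'(4) span[symmetric] by (simp add: image_image pullback_def)
    ultimately show ?thesis using T'(2,3,5) card by (meson le_trans less_imp_le)
  qed
qed

lemma partition_sum_sum: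
  assumes "finite A" "i \<in> I" "j \<in> {1..4} - I" "I \<subseteq> {1..4}"
    "\<And>p. p \<in> A \<Longrightarrow> form_on I (b p)" "\<And>p. p \<in> A \<Longrightarrow> form_on ({1..4} - I) (c p)"
  shows "partition_sum (card A) (\<lambda>x y z w. \<Sum>p\<in>A. b p x y z w * c p x y z w)"
  using assms(1,5,6)
proof (induction A)
  case empty
  then show ?case using partition_sum_0 by simp
next
  case (insert p A)
  then have "partition_sum (Suc (card A)) (\<lambda>x y z w. (\<Sum>p\<in>A. b p x y z w * c p x y z w) + b p x y z w * c p x y z w)"
    by (intro partition_sum_Suc[OF _ assms(2-4)] insert.IH insert.prems) simp_all
  then show ?case using insert.hyps by (simp add: add.commute)
qed

section \<open>Tensors over a space of bilinear forms and their coefficients\<close>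

lemma pairing_sum_map_flip: "pairing_sum (map (map_prod (\<lambda>b x y. b y x) id) ps) x y z w = pairing_sum ps y x z w"
    "pairing_sum (map (map_prod id (\<lambda>b x y. b y x)) ps) x y z w = pairing_sum ps x y w z"
    "pairing_sum (map prod.swap ps) x y z w = pairing_sum ps z w x y"
  by (induction ps) (auto simp: mult.commute)

text \<open>The number of products is recorded because cancellation against a tensor costs one
  annihilated linear form per product.\<close>

definition tensor :: "('v \<Rightarrow> 'v \<Rightarrow> bit) set \<Rightarrow> nat \<Rightarrow> 'v form \<Rightarrow> bool" where
  "tensor B m T \<longleftrightarrow> (\<exists>ps. set ps \<subseteq> B \<times> B \<and> length ps \<le> m \<and> T = pairing_sum ps)"

lemma tensor_add:
  assumes "tensor B m T" "tensor B k U"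
  shows "tensor B (m + k) (\<lambda>x y z w. T x y z w + U x y z w)"
proof -
  from assms obtain ps qs where "set ps \<subseteq> B \<times> B" "length ps \<le> m" "T = pairing_sum ps"
    "set qs \<subseteq> B \<times> B" "length qs \<le> k" "U = pairing_sum qs"
    unfolding tensor_def by blast
  then show ?thesis unfolding tensor_def
    by (intro exI[of _ "ps @ qs"]) (auto simp: fun_eq_iff)
qed

lemma tensor_flip_swap:
  assumes "tensor B m T"
  shows "(\<And>b. b \<in> B \<Longrightarrow> (\<lambda>x y. b y x) \<in> B) \<Longrightarrow> tensor B m (\<lambda>x y z w. T y x z w)"
    "(\<And>b. b \<in> B \<Longrightarrow> (\<lambda>x y. b y x) \<in> B) \<Longrightarrow> tensor B m (\<lambda>x y z w. T x y w z)"
    "tensor B m (\<lambda>x y z w. T z w x y)"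
proof -
  from assms obtain ps where ps: "set ps \<subseteq> B \<times> B" "length ps \<le> m" "T = pairing_sum ps"
    unfolding tensor_def by blast
  have T: "(\<lambda>x y z w. T y x z w) = pairing_sum (map (map_prod (\<lambda>b x y. b y x) id) ps)"
    "(\<lambda>x y z w. T x y w z) = pairing_sum (map (map_prod id (\<lambda>b x y. b y x)) ps)"
    "(\<lambda>x y z w. T z w x y) = pairing_sum (map prod.swap ps)"
    by (intro ext; simp add: ps(3) pairing_sum_map_flip)+
  have sub: "set (map prod.swap ps) \<subseteq> B \<times> B"
    using ps(1) by fastforce
  show "tensor B m (\<lambda>x y z w. T y x z w)" if "\<And>b. b \<in> B \<Longrightarrow> (\<lambda>x y. b y x) \<in> B"
    unfolding tensor_def T using ps(1,2) that
    by (intro exI[of _ "map (map_prod (\<lambda>b x y. b y x) id) ps"]) auto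
  show "tensor B m (\<lambda>x y z w. T x y w z)" if "\<And>b. b \<in> B \<Longrightarrow> (\<lambda>x y. b y x) \<in> B"
    unfolding tensor_def T using ps(1,2) that
    by (intro exI[of _ "map (map_prod id (\<lambda>b x y. b y x)) ps"]) auto
  show "tensor B m (\<lambda>x y z w. T z w x y)"
    unfolding tensor_def T using ps(2) sub by (intro exI[of _ "map prod.swap ps"]) simp
qed

lemma sum_fun_apply: "(\<Sum>i\<in>A. f i) x = (\<Sum>i\<in>A. f i x)"
  by (induction A rule: infinite_finite_induct) simp_all

text \<open>Independence is stated for indexed families, since it is also applied to the
  symmetrizations of basis forms, indexed by the basis forms themselves.\<close>

definition independent_family :: "'i set \<Rightarrow> ('i \<Rightarrow> 'v \<Rightarrow> 'v \<Rightarrow> bit) \<Rightarrow> bool" where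
  "independent_family A g \<longleftrightarrow> (\<forall>u. (\<forall>x y. (\<Sum>i\<in>A. u i * g i x y) = 0) \<longrightarrow> (\<forall>i\<in>A. u i = 0))"

lemma independent_familyD:
  "independent_family A g \<Longrightarrow> (\<And>x y. (\<Sum>i\<in>A. u i * g i x y) = 0) \<Longrightarrow> i \<in> A \<Longrightarrow> u i = 0"
  unfolding independent_family_def by blast

lemma independent_familyI:
  "finite V \<Longrightarrow> bv.independent V \<Longrightarrow> independent_family V (\<lambda>b. b)"
  unfolding independent_family_def
proof (intro allI impI ballI)
  fix u i assume "finite V" "bv.independent V" "i \<in> V" and z: "\<forall>x y. (\<Sum>i\<in>V. u i * i x y) = 0"
  have "(\<Sum>v\<in>V. bscale (u v) v) = 0"
    using z by (simp add: fun_eq_iff sum_fun_apply bscale_fun)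
  then show "u i = 0"
    using bv.independentD[of V V u i] \<open>finite V\<close> \<open>bv.independent V\<close> \<open>i \<in> V\<close> by blast
qed

text \<open>For fixed \<open>z\<close> and \<open>w\<close> the double sum is a combination of the
  \<open>g i\<close> in \<open>x\<close>, \<open>y\<close>, so its coefficients vanish; these are in
  turn combinations of the \<open>g j\<close>.\<close>

lemma independent_family_tensor:
  assumes g: "independent_family A g" and i: "i \<in> A" and j: "j \<in> A"
    and z: "\<And>x y z w. (\<Sum>i\<in>A. \<Sum>j\<in>A. d i j * g i x y * g j z w) = 0"
  shows "d i j = 0"
proof -
  have "(\<Sum>j\<in>A. d i j * g j z w) = 0" for z w
  proof -
    have "(\<Sum>i\<in>A. (\<Sum>j\<in>A. d i j * g j z w) * g i x y) = 0" for x y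
      using z[of x y z w] by (simp add: sum_distrib_left mult_ac)
    from independent_familyD[where u = "\<lambda>i. \<Sum>j\<in>A. d i j * g j z w", OF g this i] show ?thesis .
  qed
  from independent_familyD[where u = "d i", OF g this j] show ?thesis .
qed

lemma tensor_coefficients:
  assumes "tensor (bv.span V) m T" "finite V"
  shows "\<exists>d. \<forall>x y z w. T x y z w = (\<Sum>i\<in>V. \<Sum>j\<in>V. d i j * i x y * j z w)"
proof -
  from assms(1) obtain ps where "set ps \<subseteq> bv.span V \<times> bv.span V" "T = pairing_sum ps"
    unfolding tensor_def by blast
  moreover have "\<exists>d. \<forall>x y z w. pairing_sum ps x y z w = (\<Sum>i\<in>V. \<Sum>j\<in>V. d i j * i x y * j z w)"
    if "set ps \<subseteq> bv.span V \<times> bv.span V" for ps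
    using that
  proof (induction ps)
    case Nil
    then show ?case by (intro exI[of _ "\<lambda>_ _. 0"]) simp
  next
    case (Cons p ps)
    obtain b c where p: "p = (b, c)" by fastforce
    with Cons.prems have "b \<in> bv.span V" "c \<in> bv.span V" by auto
    then obtain s t where "b = (\<Sum>i\<in>V. bscale (s i) i)" "c = (\<Sum>i\<in>V. bscale (t i) i)"
      using bv.span_finite[OF assms(2)] by auto
    then have bc: "b x y = (\<Sum>i\<in>V. s i * i x y)" "c x y = (\<Sum>i\<in>V. t i * i x y)" for x y
      by (simp_all add: sum_fun_apply bscale_fun)
    obtain d where d: "\<And>x y z w. pairing_sum ps x y z w = (\<Sum>i\<in>V. \<Sum>j\<in>V. d i j * i x y * j z w)"
      using Cons by force
    show ?case unfolding p
      by (intro exI[of _ "\<lambda>i j. s i * t j + d i j"])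
        (simp add: d bc sum_product sum.distrib distrib_left distrib_right mult_ac)
  qed
  ultimately show ?thesis by blast
qed

lemma sum_symmetric_char2:
  fixes f :: "'i \<Rightarrow> 'i \<Rightarrow> 'v::boolean_group"
  assumes "\<And>i j. i \<in> A \<Longrightarrow> j \<in> A \<Longrightarrow> f i j = f j i"
  shows "(\<Sum>i\<in>A. \<Sum>j\<in>A. f i j) = (\<Sum>i\<in>A. f i i)"
  using assms
proof (induction A rule: infinite_finite_induct)
  case (insert k A)
  have "(\<Sum>i\<in>insert k A. \<Sum>j\<in>insert k A. f i j)
      = f k k + ((\<Sum>j\<in>A. f k j) + (\<Sum>i\<in>A. f i k)) + (\<Sum>i\<in>A. \<Sum>j\<in>A. f i j)"
    using insert.hyps by (simp add: sum.distrib add_ac)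
  also have "(\<Sum>j\<in>A. f k j) = (\<Sum>i\<in>A. f i k)"
    using insert.prems by (intro sum.cong) auto
  also have "(\<Sum>i\<in>A. \<Sum>j\<in>A. f i j) = (\<Sum>i\<in>A. f i i)"
    using insert by blast
  finally show ?case using insert.hyps by simp
qed simp_all

section \<open>Uniqueness of pairing representations over a regular space\<close>

locale regular_space =
  fixes B :: "('v::boolean_group \<Rightarrow> 'v \<Rightarrow> bit) set" and c :: nat
  assumes subspace: "bv.subspace B"
    and bilinear: "b \<in> B \<Longrightarrow> bilinear b"
    and flip: "b \<in> B \<Longrightarrow> (\<lambda>x y. b y x) \<in> B"
    and regular: "regular c B"
begin

lemma tensor_slice:
  assumes "tensor B m T"
  shows "T x y \<in> B"
proof -
  have "pairing_sum ps x y \<in> B" if "set ps \<subseteq> B \<times> B" for ps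
    using that
  proof (induction ps)
    case Nil
    have "pairing_sum [] x y = 0" by (simp add: fun_eq_iff)
    then show ?case using bv.subspace_0[OF subspace] by (simp only:)
  next
    case (Cons p ps)
    obtain b c where p: "p = (b, c)" by fastforce
    have "pairing_sum (p # ps) x y = bscale (b x y) c + pairing_sum ps x y"
      by (simp add: p fun_eq_iff bscale_fun)
    also have "\<dots> \<in> B"
      using Cons p by (intro bv.subspace_add bv.subspace_scale subspace) auto
    finally show ?case .
  qed
  then show ?thesis using assms unfolding tensor_def by blast
qed

text \<open>With \<open>x\<close> and \<open>y\<close> fixed, every product in \<open>Q\<close> and
  in \<open>R\<close> contains a factor linear in \<open>z\<close>. A map \<open>\<pi>\<close>
  annihilating these \<open>j + k\<close> linear forms kills the form \<open>P x y\<close>, which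
  lies in \<open>B\<close> and hence is zero by regularity.\<close>

lemma tensor_cancel_first:
  assumes P: "tensor B i P" and Q: "tensor B j Q" and R: "tensor B k R" and c: "j + k \<le> c"
    and z: "\<And>x y z w. P x y z w + Q x z y w + R x w y z = 0"
  shows "P x y z w = 0"
proof -
  from Q R obtain qs rs where qs: "set qs \<subseteq> B \<times> B" "length qs \<le> j" "Q = pairing_sum qs"
    and rs: "set rs \<subseteq> B \<times> B" "length rs \<le> k" "R = pairing_sum rs"
    unfolding tensor_def by blast
  let ?ls = "map (\<lambda>p. fst p x) qs @ map (\<lambda>p. snd p y) rs"
  have "\<exists>\<pi>. near_id c \<pi> \<and> (\<forall>l\<in>set ?ls. \<forall>x. l (\<pi> x) = 0)"
    using qs rs c bilinear by (intro near_id_annihilating) (auto simp: bilinear_def)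
  then obtain \<pi> where \<pi>: "near_id c \<pi>" "\<And>l u. l \<in> set ?ls \<Longrightarrow> l (\<pi> u) = 0"
    by blast
  have "pairing_sum qs x (\<pi> u) y v = 0" for u v
  proof -
    have "\<forall>p\<in>set qs. fst p x (\<pi> u) = 0"
      using \<pi>(2) by auto
    then show ?thesis by (induction qs) auto
  qed
  moreover have "pairing_sum rs x v y (\<pi> u) = 0" for u v
  proof -
    have "\<forall>p\<in>set rs. snd p y (\<pi> u) = 0"
      using \<pi>(2) by auto
    then show ?thesis by (induction rs) auto
  qed
  ultimately have "P x y (\<pi> u) (\<pi> v) = 0" for u v
    using z[of x y "\<pi> u" "\<pi> v"] qs(3) rs(3) by simp
  then have "pullback \<pi> (P x y) = 0"
    by (simp add: pullback_def fun_eq_iff)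
  then have "P x y = 0"
    using regular \<pi>(1) tensor_slice[OF P] unfolding regular_def by blast
  then show ?thesis by simp
qed

text \<open>Exchanging \<open>y\<close> and \<open>z\<close> interchanges the roles of
  \<open>P\<close> and \<open>Q\<close> and flips the second factor of \<open>R\<close>.\<close>

lemma tensor_cancel:
  assumes P: "tensor B i P" and Q: "tensor B j Q" and R: "tensor B k R" and c: "i + j + k \<le> c"
    and z: "\<And>x y z w. P x y z w + Q x z y w + R x w y z = 0"
  shows "P x y z w = 0" "Q x y z w = 0"
proof -
  show "P x y z w = 0"
    using c by (intro tensor_cancel_first[OF P Q R _ z]) simp
  have "Q x y z w + P x z y w + R x w z y = 0" for x y z w
    using z[of x z y w] by (simp add: add_ac)
  then show "Q x y z w = 0"
    using c by (intro tensor_cancel_first[OF Q P tensor_flip_swap(2)[OF R flip]]) simp_all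
qed

end

section \<open>Symmetrization\<close>

text \<open>Each symmetry of \<open>a\<close> makes a sum of permuted copies of
  \<open>\<rho>\<close> vanish, and \<open>tensor_cancel\<close> splits that sum by pairing. The
  largest such sum has three copies, whence the factor 3 in the bound on \<open>c\<close>.\<close>

lemma (in regular_space) pairing_relations:
  assumes sym12: "\<And>x y z w. a x y z w = a y x z w" and sym23: "\<And>x y z w. a x y z w = a x z y w"
    and alt: "\<And>x z w. a x x z w = 0"
    and C: "tensor B i C" and D: "tensor B j D" and E: "tensor B k E" and c: "3 * (i + j + k) \<le> c"
    and rho: "\<And>x y z w. a x y z w + a x y w z = C x y z w + D x z y w + E x w y z"
  shows "E x y z w = D x y z w" "D x y z w = D z w x y" "C x y z w = D x y z w + D x y w z"
    "D x y z w + D x y w z + D y x z w + D y x w z = 0" "D x y x y + D x x y y = 0"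
proof -
  note fl = tensor_flip_swap(1,2)[OF _ flip]
  \<comment> \<open>Here \<open>\<rho>\<close> is invariant under exchanging the last two variables,
    which interchanges the pairings of \<open>D\<close> and \<open>E\<close>.\<close>
  have "D x y z w + E x y z w = 0" for x y z w
  proof (rule tensor_cancel(2)[OF tensor_add[OF C fl(2)[OF C]] tensor_add[OF D E] tensor_add[OF E D]])
    fix x y z w
    have "a x y z w + a x y w z + (a x y w z + a x y z w) = 0"
      by (simp add: add_ac)
    then show "C x y z w + C x y w z + (D x z y w + E x z y w) + (E x w y z + D x w y z) = 0"
      unfolding rho by (simp only: add_ac)
  qed (use c in simp_all)
  then show ED: "E x y z w = D x y z w" for x y z w
    by (simp add: add_eq_0_iff_eq)
  have CC: "C x y z w + C y x z w = 0" and DE: "D x y z w + E z w x y = 0" for x y z w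
  proof -
    \<comment> \<open>Now \<open>\<rho>\<close> is invariant under exchanging the first two
      variables.\<close>
    have eq: "C x y z w + C y x z w + (D x z y w + E y w x z) + (E x w y z + D y z x w) = 0" for x y z w
    proof -
      have "a x y z w + a x y w z + (a y x z w + a y x w z) = 0"
        by (simp add: sym12[of y x] add_ac)
      then show ?thesis unfolding rho by (simp only: add_ac)
    qed
    note cancel = tensor_cancel[OF tensor_add[OF C fl(1)[OF C]] tensor_add[OF D tensor_flip_swap(3)[OF E]]
        tensor_add[OF E tensor_flip_swap(3)[OF D]] _ eq]
    show "C x y z w + C y x z w = 0" using cancel(1) c by simp
    show "D x y z w + E z w x y = 0" using cancel(2) c by simp
  qed
  then show DD: "D x y z w = D z w x y" for x y z w
    by (simp add: add_eq_0_iff_eq ED)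
  \<comment> \<open>The three copies of \<open>\<rho>\<close> run through \<open>a\<close> at all
    six orders of the last three variables, and these values agree in pairs by
    \<open>sym23\<close>.\<close>
  have "C x y z w + D x y z w + E x y w z = 0" for x y z w
  proof (rule tensor_cancel(1)[OF tensor_add[OF tensor_add[OF C D] fl(2)[OF E]]
        tensor_add[OF tensor_add[OF D C] fl(2)[OF D]] tensor_add[OF tensor_add[OF E fl(2)[OF E]] fl(2)[OF C]]])
    fix x y z w
    have "(a x y z w + a x y w z) + (a x z y w + a x z w y) + (a x w z y + a x w y z) = 0"
      by (simp add: sym23[of x z y] sym23[of x w z] sym23[of x w y] add_ac)
    then show "C x y z w + D x y z w + E x y w z + (D x z y w + C x z y w + D x z w y) +
        (E x w y z + E x w z y + C x w z y) = 0"
      unfolding rho by (simp only: add_ac)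
  qed (use c in simp_all)
  then show CD: "C x y z w = D x y z w + D x y w z" for x y z w
    by (simp add: ED add_eq_0_iff_eq add.assoc)
  show "D x y z w + D x y w z + D y x z w + D y x w z = 0"
    using CC[of x y z w] by (simp add: CD add_ac)
  \<comment> \<open>Both values can be permuted so that equal arguments come first, where
    \<open>a\<close> vanishes.\<close>
  have "a x y x y + a x y y x = 0"
    by (simp add: sym23[of x y x] sym12[of x y y] sym23[of y x y] alt)
  then show "D x y x y + D x x y y = 0"
    unfolding rho CD ED by (simp add: add_ac)
qed

text \<open>The last right-hand side is \<open>\<rho>\<close> as rewritten by
  \<open>pairing_relations\<close>. Hence adding \<open>w\<close> repairs the symmetry in the last
  two variables while preserving that in the first three.\<close>

lemma (in regular_space) symmetric_correction:
  assumes D: "tensor B m D" and fin: "finite S" and S: "B = bv.span S" and c: "card S \<le> c"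
    and swap: "\<And>x y z w. D x y z w = D z w x y"
    and flips: "\<And>x y z w. D x y z w + D x y w z + D y x z w + D y x w z = 0"
    and diag: "\<And>x y. D x y x y + D x x y y = 0"
  shows "\<exists>w. quadrilinear w \<and> partition_sum (3 * (card S)\<^sup>2) w \<and>
    (\<forall>x y z u. w x y z u = w y x z u \<and> w x y z u = w x z y u \<and>
      w x y z u + w x y u z = D x y z u + D x y u z + D x z y u + D x u y z)"
proof -
  define K where "K = {b \<in> B. \<forall>x y. b x y = b y x}"
  have K: "bv.subspace K"
    using subspace unfolding bv.subspace_def K_def by (auto simp: bscale_fun)
  obtain U where U: "U \<subseteq> K" "bv.independent U" "K \<subseteq> bv.span U"
    using bv.maximal_independent_subset by blast
  have "U \<subseteq> B" using U(1) by (auto simp: K_def)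
  then obtain V where V: "U \<subseteq> V" "V \<subseteq> B" "bv.independent V" "B \<subseteq> bv.span V"
    using bv.maximal_independent_subset_extend U(2) by metis
  have finV: "finite V" and cardV: "card V \<le> card S"
    using bv.independent_span_bound[OF fin V(3)] V(2) S by auto
  have spanV: "bv.span V = B"
    using V(2,4) subspace by (intro bv.span_subspace)
  have Usym: "i x y = i y x" if "i \<in> U" for i x y
    using that U(1) by (auto simp: K_def)
  from D have "tensor (bv.span V) m D"
    unfolding spanV .
  from tensor_coefficients[OF this finV]
  obtain d where "\<forall>x y z w. D x y z w = (\<Sum>i\<in>V. \<Sum>j\<in>V. d i j * i x y * j z w)" ..
  then have d: "D x y z w = (\<Sum>i\<in>V. \<Sum>j\<in>V. d i j * i x y * j z w)" for x y z w
    by blast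
  have dsym: "d i j = d j i" if "i \<in> V" "j \<in> V" for i j
  proof -
    have "d i j + d j i = 0"
    proof (rule independent_family_tensor[OF independent_familyI[OF finV V(3)] that])
      fix x y z w
      have "D x y z w + D z w x y = 0"
        by (simp add: swap[of z w])
      also have "D z w x y = (\<Sum>i\<in>V. \<Sum>j\<in>V. d j i * i x y * j z w)"
        unfolding d by (subst sum.swap) (simp add: mult_ac)
      finally show "(\<Sum>i\<in>V. \<Sum>j\<in>V. (d i j + d j i) * i x y * j z w) = 0"
        unfolding d by (simp add: distrib_right sum.distrib)
    qed
    then show ?thesis by (simp add: add_eq_0_iff_eq)
  qed
  define W where "W = V - U"
  \<comment> \<open>A combination of \<open>W\<close> whose symmetrization vanishes is a symmetric
    form in \<open>B\<close>, so it lies in the span of \<open>U\<close>; independence of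
    \<open>V\<close> makes it trivial.\<close>
  have indW: "independent_family W (\<lambda>i x y. i x y + i y x)"
    unfolding independent_family_def
  proof (intro allI impI ballI)
    fix u i assume i: "i \<in> W" and z: "\<forall>x y. (\<Sum>i\<in>W. u i * (i x y + i y x)) = 0"
    define v where "v = (\<Sum>i\<in>W. bscale (u i) i)"
    have v: "v x y = (\<Sum>i\<in>W. u i * i x y)" for x y
      by (simp add: v_def sum_fun_apply bscale_fun)
    have "v x y + v y x = 0" for x y
      using z unfolding v by (simp add: distrib_left sum.distrib)
    moreover have "v \<in> B"
      unfolding v_def using V(2) by (intro bv.subspace_sum bv.subspace_scale subspace) (auto simp: W_def)
    ultimately have "v \<in> bv.span U"
      using U(3) by (auto simp: K_def add_eq_0_iff_eq)
    then obtain t where "v = (\<Sum>i\<in>U. bscale (t i) i)"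
      using bv.span_finite[of U] finV V(1) finite_subset by auto
    then have t: "v x y = (\<Sum>i\<in>U. t i * i x y)" for x y
      by (simp add: sum_fun_apply bscale_fun)
    have "(\<Sum>i\<in>V. (if i \<in> U then t i else u i) * i x y) = 0" for x y
    proof -
      have "(\<Sum>i\<in>V. (if i \<in> U then t i else u i) * i x y) = (\<Sum>i\<in>W. u i * i x y) + (\<Sum>i\<in>U. t i * i x y)"
        unfolding W_def sum.subset_diff[OF V(1) finV]
        by (intro arg_cong2[where f = "(+)"] sum.cong) auto
      then show ?thesis using v t by simp
    qed
    from independent_familyD[OF independent_familyI[OF finV V(3)] this, of i]
    show "u i = 0" using i by (simp add: W_def)
  qed
  \<comment> \<open>The sum of the four transposes of \<open>D\<close> replaces each basis form by
    its symmetrization. Those from \<open>U\<close> vanish, and those from \<open>W\<close> are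
    independent.\<close>
  have dW: "d i j = 0" if "i \<in> W" "j \<in> W" for i j
  proof (rule independent_family_tensor[OF indW that])
    fix x y z w
    have "(\<Sum>i\<in>W. \<Sum>j\<in>W. d i j * (i x y + i y x) * (j z w + j w z))
        = (\<Sum>i\<in>V. \<Sum>j\<in>W. d i j * (i x y + i y x) * (j z w + j w z))"
      using finV Usym by (intro sum.mono_neutral_left) (auto simp: W_def)
    also have "\<dots> = (\<Sum>i\<in>V. \<Sum>j\<in>V. d i j * (i x y + i y x) * (j z w + j w z))"
      using finV Usym by (intro sum.cong sum.mono_neutral_left) (auto simp: W_def)
    also have "\<dots> = D x y z w + D x y w z + D y x z w + D y x w z"
      unfolding d by (simp add: distrib_left distrib_right sum.distrib add_ac)
    finally show "(\<Sum>i\<in>W. \<Sum>j\<in>W. d i j * (i x y + i y x) * (j z w + j w z)) = 0"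
      using flips by simp
  qed
  have ddiag: "d i i = 0" if i: "i \<in> V" for i
  proof -
    obtain us where us: "set us = U" "length us = card U"
      using finite_distinct_list[of U] finV V(1) finite_subset distinct_card by metis
    \<comment> \<open>For a symmetric form the cross terms cancel, so its diagonal is a linear form
      and can be annihilated by a map close to the identity.\<close>
    have add: "additive (\<lambda>x. i x x)" if "i \<in> U" for i
    proof -
      have "bilinear i" using that V bilinear by blast
      then have "i (x + y) (x + y) = i x x + i x y + (i y x + i y y)" for x y
        by (simp add: bilinear_def additive_def add_ac)
      then show ?thesis by (simp add: additive_def Usym[OF that] add.assoc)
    qed
    have "\<exists>\<pi>. near_id c \<pi> \<and> (\<forall>l\<in>set (map (\<lambda>i x. i x x) us). \<forall>x. l (\<pi> x) = 0)"
      using us add card_mono[OF finV V(1)] cardV c by (intro near_id_annihilating) auto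
    then obtain \<pi> where \<pi>: "near_id c \<pi>" "\<And>i x. i \<in> U \<Longrightarrow> i (\<pi> x) (\<pi> x) = 0"
      using us by auto
    define v where "v = (\<Sum>i\<in>V. bscale (d i i) i)"
    have v: "v x y = (\<Sum>i\<in>V. d i i * i x y)" for x y
      by (simp add: v_def sum_fun_apply bscale_fun)
    have vB: "v \<in> B"
      unfolding v_def using V(2) by (intro bv.subspace_sum bv.subspace_scale subspace) auto
    \<comment> \<open>Off-diagonal terms cancel in pairs by symmetry of \<open>d\<close>, and on the
      diagonal the square of a bit is that bit.\<close>
    have Dv: "D x y x y = v x y" for x y
    proof -
      have "D x y x y = (\<Sum>i\<in>V. d i i * i x y * i x y)"
        unfolding d using dsym by (intro sum_symmetric_char2) (simp add: mult_ac)
      also have "\<dots> = v x y"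
        unfolding v by (intro sum.cong refl) (metis bit_not_one_iff mult_zero_right mult.right_neutral)
      finally show ?thesis .
    qed
    \<comment> \<open>By \<open>dW\<close>, every nonzero coefficient has an index in
      \<open>U\<close>, and \<open>\<pi>\<close> kills the diagonal of that basis form.\<close>
    have "D (\<pi> x) (\<pi> x) (\<pi> y) (\<pi> y) = 0" for x y
      unfolding d
    proof (intro sum.neutral ballI)
      fix i j assume "i \<in> V" "j \<in> V"
      then show "d i j * i (\<pi> x) (\<pi> x) * j (\<pi> y) (\<pi> y) = 0"
        using dW[of i j] \<pi>(2) by (auto simp: W_def)
    qed
    then have "pullback \<pi> v = 0"
      using diag by (simp add: pullback_def fun_eq_iff flip: Dv) (metis add.right_neutral)
    then have "v = 0"
      using regular \<pi>(1) vB unfolding regular_def by blast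
    then have "(\<Sum>i\<in>V. d i i * i x y) = 0" for x y
      using v by simp
    from independent_familyD[OF independent_familyI[OF finV V(3)] this i] show ?thesis .
  qed
  obtain e :: "('v \<Rightarrow> 'v \<Rightarrow> bit) \<Rightarrow> nat" where e: "inj_on e V"
    using finite_imp_inj_to_nat_seg[OF finV] by blast
  \<comment> \<open>half of the symmetric matrix \<open>d\<close>, with first index in \<open>U\<close> so that \<open>F\<close> is symmetric in its first two arguments\<close>
  define f where "f i j = (if i \<in> U \<and> (j \<notin> U \<or> e i < e j) then d i j else 0)" for i j
  \<comment> \<open>For two distinct indices in \<open>U\<close> the numbering \<open>e\<close>
    selects one order; for a mixed pair the index in \<open>U\<close> comes first; equal indices and
    pairs outside \<open>U\<close> have coefficient zero.\<close>
  have fd: "f i j + f j i = d i j" if "i \<in> V" "j \<in> V" for i j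
  proof -
    have "i = j \<or> e i < e j \<or> e j < e i"
      using inj_onD[OF e _ that] by fastforce
    then show ?thesis
      using dW[of i j] dsym[OF that] ddiag that by (auto simp: f_def W_def)
  qed
  define F where "F x y z w = (\<Sum>i\<in>V. \<Sum>j\<in>V. f i j * i x y * j z w)" for x y z w
  have Fsym: "F x y z w = F y x z w" for x y z w
    unfolding F_def by (intro sum.cong refl) (auto simp: f_def Usym)
  have FD: "D x y z w = F x y z w + F z w x y" for x y z w
  proof -
    have "F z w x y = (\<Sum>i\<in>V. \<Sum>j\<in>V. f j i * i x y * j z w)"
      unfolding F_def by (subst sum.swap) (simp add: mult_ac)
    then have "F x y z w + F z w x y = (\<Sum>i\<in>V. \<Sum>j\<in>V. (f i j + f j i) * i x y * j z w)"
      by (simp add: F_def distrib_right sum.distrib)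
    also have "\<dots> = D x y z w"
      unfolding d using fd by (intro sum.cong refl) simp
    finally show ?thesis ..
  qed
  have bil: "i (x + y) z = i x z + i y z" "i z (x + y) = i z x + i z y" if "i \<in> V" for i x y z
    using that V(2) bilinear by (auto simp: bilinear_def additive_def)
  have Fadd: "F (x + x') y z w = F x y z w + F x' y z w" "F x (y + y') z w = F x y z w + F x y' z w"
      "F x y (z + z') w = F x y z w + F x y z' w" "F x y z (w + w') = F x y z w + F x y z w'"
    for x x' y y' z z' w w'
    by (simp_all add: F_def bil distrib_left distrib_right sum.distrib cong: sum.cong)
  have F_pair: "F x y z w = (\<Sum>p\<in>V \<times> V. (f (fst p) (snd p) * fst p x y) * snd p z w)" for x y z w
    unfolding F_def by (simp add: sum.cartesian_product split_def)
  have finVV: "finite (V \<times> V)" and cardVV: "card (V \<times> V) \<le> (card S)\<^sup>2"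
    using finV cardV by (auto simp: power2_eq_square mult_mono)
  note part = partition_sum_mono[OF partition_sum_sum[OF finVV] cardVV]
  have p12: "partition_sum ((card S)\<^sup>2) (\<lambda>x y z w. F x y z w)"
    unfolding F_pair
    by (rule part[of 1 "{1, 2}" 3]) (auto simp: form_on_def varies_in_def additive_def bil distrib_left)
  have p13: "partition_sum ((card S)\<^sup>2) (\<lambda>x y z w. F x z y w)"
    unfolding F_pair
    by (rule part[of 1 "{1, 3}" 2]) (auto simp: form_on_def varies_in_def additive_def bil distrib_left)
  have p23: "partition_sum ((card S)\<^sup>2) (\<lambda>x y z w. F y z x w)"
    unfolding F_pair
    by (rule part[of 2 "{2, 3}" 1]) (auto simp: form_on_def varies_in_def additive_def bil distrib_left)
  show ?thesis
  proof (intro exI[of _ "\<lambda>x y z w. F x y z w + F x z y w + F y z x w"] conjI allI)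
    show "quadrilinear (\<lambda>x y z w. F x y z w + F x z y w + F y z x w)"
      unfolding quadrilinear_iff by (simp add: Fadd add_ac)
    have "partition_sum ((card S)\<^sup>2 + (card S)\<^sup>2 + (card S)\<^sup>2) (\<lambda>x y z w. F x y z w + F x z y w + F y z x w)"
      by (intro partition_sum_add p12 p13 p23)
    then show "partition_sum (3 * (card S)\<^sup>2) (\<lambda>x y z w. F x y z w + F x z y w + F y z x w)"
      by (simp add: mult.commute numeral_3_eq_3 add_ac)
  next
    fix x y z w
    show "F x y z w + F x z y w + F y z x w = F y x z w + F y z x w + F x z y w"
      by (simp add: Fsym[of y x] add_ac)
    show "F x y z w + F x z y w + F y z x w = F x z y w + F x y z w + F z y x w"
      by (simp add: Fsym[of z y] add_ac)
    \<comment> \<open>Expanding \<open>D\<close> by \<open>FD\<close>, the two extra terms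
      \<open>F z w x y\<close> and \<open>F w z x y\<close> cancel by symmetry of \<open>F\<close>
      in its first two arguments.\<close>
    show "F x y z w + F x z y w + F y z x w + (F x y w z + F x w y z + F y w x z) =
        D x y z w + D x y w z + D x z y w + D x w y z"
      unfolding FD by (simp add: Fsym[of w z] add_ac)
  qed
qed

section \<open>Assembly of the symmetrization theorem\<close>

lemma tensor_pullback:
  assumes "set ps \<subseteq> S \<times> S" "\<And>b. b \<in> S \<Longrightarrow> pullback \<pi> b \<in> B"
  shows "tensor B (length ps) (\<lambda>x y z w. pairing_sum ps (\<pi> x) (\<pi> y) (\<pi> z) (\<pi> w))"
  unfolding tensor_def
proof (intro exI[of _ "map (map_prod (pullback \<pi>) (pullback \<pi>)) ps"] conjI)
  show "set (map (map_prod (pullback \<pi>) (pullback \<pi>)) ps) \<subseteq> B \<times> B"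
    using assms by auto
  have "pairing_sum ps (\<pi> x) (\<pi> y) (\<pi> z) (\<pi> w) = pairing_sum (map (map_prod (pullback \<pi>) (pullback \<pi>)) ps) x y z w"
    for x y z w
    by (induction ps) (auto simp: pullback_def)
  then show "(\<lambda>x y z w. pairing_sum ps (\<pi> x) (\<pi> y) (\<pi> z) (\<pi> w)) = pairing_sum (map (map_prod (pullback \<pi>) (pullback \<pi>)) ps)"
    by blast
qed simp

lemma subspace_bilinear: "bv.subspace (Collect bilinear)"
  unfolding bv.subspace_def
  by (auto simp: bilinear_def additive_def bscale_def add_ac)

lemma bilinear_pullback: "bilinear b \<Longrightarrow> additive \<pi> \<Longrightarrow> bilinear (pullback \<pi> b)"
  by (simp add: bilinear_def additive_def pullback_def)

text \<open>The regularized span is a pullback of the span of \<open>S\<close>, and pullbacks along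
  additive maps preserve bilinearity and commute with transposition.\<close>

lemma regularized_space:
  fixes S :: "('v::boolean_group \<Rightarrow> 'v \<Rightarrow> bit) set"
  assumes fin: "finite S" and bil: "S \<subseteq> Collect bilinear" and flip: "\<And>b. b \<in> S \<Longrightarrow> (\<lambda>x y. b y x) \<in> S"
  obtains \<pi> T where "near_id (card S * c) \<pi>" "finite T" "card T \<le> card S" "regular_space (bv.span T) c"
    "\<And>b. b \<in> S \<Longrightarrow> pullback \<pi> b \<in> bv.span T"
proof -
  obtain \<pi> T where \<pi>: "near_id (card S * c) \<pi>" and T: "finite T" "card T \<le> card S"
    "bv.span T = pullback \<pi> ` bv.span S" "regular c (bv.span T)"
    using regularize[OF fin, of c] by blast
  have bilS: "bilinear b" if "b \<in> bv.span S" for b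
    using bv.span_minimal[OF bil subspace_bilinear] that by blast
  have flipS: "(\<lambda>x y. b y x) \<in> bv.span S" if "b \<in> bv.span S" for b
    using that
  proof (induction rule: bv.span_induct_alt)
    case base
    have "(\<lambda>x y. (0 :: 'v \<Rightarrow> 'v \<Rightarrow> bit) y x) = 0" by (simp add: fun_eq_iff)
    then show ?case using bv.span_zero[of S] by (simp only:)
  next
    case (step a b d)
    have "(\<lambda>x y. (bscale a b + d) y x) = bscale a (\<lambda>x y. b y x) + (\<lambda>x y. d y x)"
      by (simp add: fun_eq_iff bscale_fun)
    also have "\<dots> \<in> bv.span S"
      by (rule bv.span_add[OF bv.span_scale[OF bv.span_base[OF flip[OF step(1)]]] step(2)])
    finally show ?case .
  qed
  have "regular_space (bv.span T) c"
  proof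
    show "bv.subspace (bv.span T)" by (rule bv.subspace_span)
    show "regular c (bv.span T)" by (rule T(4))
    fix b assume "b \<in> bv.span T"
    then obtain b' where b': "b = pullback \<pi> b'" "b' \<in> bv.span S"
      unfolding T(3) by blast
    then show "bilinear b"
      using bilS near_id_additive[OF \<pi>] bilinear_pullback by blast
    have "(\<lambda>x y. b y x) = pullback \<pi> (\<lambda>x y. b' y x)"
      by (simp add: b'(1) pullback_def)
    then show "(\<lambda>x y. b y x) \<in> bv.span T"
      unfolding T(3) using flipS[OF b'(2)] by blast
  qed
  moreover have "pullback \<pi> b \<in> bv.span T" if "b \<in> S" for b
    unfolding T(3) using bv.span_base[OF that] by blast
  ultimately show thesis using that \<pi> T(1,2) by blast
qed

text \<open>The total pullback differs from the identity by rank at most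
  \<open>r + 16 * r\<^sup>2\<close>, which costs \<open>4 * r + 64 * r\<^sup>2\<close> terms; the
  correction costs \<open>3 * (4 * r)\<^sup>2\<close> more.\<close>

theorem symmetrization:
  fixes a :: "'v::boolean_group form"
  assumes quad: "quadrilinear a"
    and sym12: "\<And>x y z w. a x y z w = a y x z w" and sym23: "\<And>x y z w. a x y z w = a x z y w"
    and alt: "\<And>x z w. a x x z w = 0"
    and rho: "partition_sum r (\<lambda>x y z w. a x y z w + a x y w z)"
  shows "\<exists>a'. quadrilinear a' \<and>
    (\<forall>x y z w. a' x y z w = a' y x z w \<and> a' x y z w = a' x z y w \<and> a' x y z w = a' x y w z) \<and>
    partition_sum (4 * r + 112 * r\<^sup>2) (\<lambda>x y z w. a x y z w + a' x y z w)"
proof -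
  obtain ls ps qs rs where dec: "pairing_decomposition r ls ps qs rs (\<lambda>x y z w. a x y z w + a x y w z)"
    using partition_sum_pairings[OF rho] by blast
  have ls: "\<And>l. l \<in> set ls \<Longrightarrow> additive l" "length ls \<le> r"
    and len: "length ps + length qs + length rs \<le> r"
    and bil: "set ps \<union> set qs \<union> set rs \<subseteq> Collect bilinear \<times> Collect bilinear"
    using dec unfolding pairing_decomposition_def by (blast, linarith, linarith, blast)
  obtain \<sigma> where \<sigma>: "near_id r \<sigma>" "\<forall>l\<in>set ls. \<forall>x. l (\<sigma> x) = 0"
    using near_id_annihilating[OF ls] by blast
  define L where "L = set ps \<union> set qs \<union> set rs"
  \<comment> \<open>Both factors of every pairing enter together with their transposes, so
    \<open>S\<close> is closed under transposition and has at most four forms per pairing.\<close>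
  define S where "S = (\<Union>(b, d)\<in>L. {pullback \<sigma> b, pullback \<sigma> (\<lambda>x y. b y x), pullback \<sigma> d, pullback \<sigma> (\<lambda>x y. d y x)})"
  have finL: "finite L" and cardL: "card L \<le> r"
  proof -
    have "card L \<le> length (ps @ qs @ rs)"
      using card_length[of "ps @ qs @ rs"] by (simp add: L_def Un_assoc)
    then show "card L \<le> r" using len by simp
  qed (simp add: L_def)
  have finS: "finite S"
    unfolding S_def using finL by auto
  have "card S \<le> (\<Sum>p\<in>L. 4)"
    unfolding S_def
  proof (rule order_trans[OF card_UN_le[OF finL] sum_mono])
    fix p :: "('v \<Rightarrow> 'v \<Rightarrow> bit) \<times> ('v \<Rightarrow> 'v \<Rightarrow> bit)"
    show "card (case p of (b, d) \<Rightarrow> {pullback \<sigma> b, pullback \<sigma> (\<lambda>x y. b y x), pullback \<sigma> d, pullback \<sigma> (\<lambda>x y. d y x)}) \<le> 4"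
      by (cases p) (simp add: card_insert_if)
  qed
  then have cardS: "card S \<le> 4 * r"
    using cardL by simp
  have bilL: "bilinear b \<and> bilinear d" if "(b, d) \<in> L" for b d
    using that bil by (auto simp: L_def)
  have bilS: "S \<subseteq> Collect bilinear"
  proof
    fix g assume "g \<in> S"
    then obtain b where "bilinear b" and g: "g = pullback \<sigma> b \<or> g = pullback \<sigma> (\<lambda>x y. b y x)"
      using bilL unfolding S_def by blast
    then have "bilinear (\<lambda>x y. b y x)" by (simp add: bilinear_def)
    then show "g \<in> Collect bilinear"
      using g \<open>bilinear b\<close> bilinear_pullback near_id_additive[OF \<sigma>(1)] by blast
  qed
  have flipS: "(\<lambda>x y. g y x) \<in> S" if "g \<in> S" for g
    using that unfolding S_def by (auto simp: pullback_def)
  \<comment> \<open>Regularity \<open>4 * r\<close> serves two purposes: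
    \<open>pairing_relations\<close> asks for three times the number of pairings, and
    \<open>symmetric_correction\<close> asks for \<open>card T\<close>.\<close>
  obtain \<tau> T where \<tau>: "near_id (card S * (4 * r)) \<tau>" and T: "finite T" "card T \<le> card S"
    "regular_space (bv.span T) (4 * r)" "\<And>b. b \<in> S \<Longrightarrow> pullback \<tau> b \<in> bv.span T"
    using regularized_space[OF finS bilS flipS, where c = "4 * r"] by blast
  interpret regular_space "bv.span T" "4 * r" by (rule T(3))
  define \<pi> where "\<pi> x = \<sigma> (\<tau> x)" for x
  define S' where "S' = fst ` L \<union> snd ` L"
  have pb: "pullback \<pi> b \<in> bv.span T" if "b \<in> S'" for b
  proof -
    have "pullback \<sigma> b \<in> S"
      using that unfolding S_def S'_def by force
    moreover have "pullback \<pi> b = pullback \<tau> (pullback \<sigma> b)"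
      by (simp add: pullback_def \<pi>_def)
    ultimately show ?thesis using T(4) by simp
  qed
  have "L \<subseteq> S' \<times> S'"
    using subset_fst_snd[of L] unfolding S'_def by blast
  then have sub: "set ps \<subseteq> S' \<times> S'" "set qs \<subseteq> S' \<times> S'" "set rs \<subseteq> S' \<times> S'"
    unfolding L_def by blast+
  define a1 where "a1 x y z w = a (\<pi> x) (\<pi> y) (\<pi> z) (\<pi> w)" for x y z w
  define C D E where "C = (\<lambda>x y z w. pairing_sum ps (\<pi> x) (\<pi> y) (\<pi> z) (\<pi> w))"
    and "D = (\<lambda>x y z w. pairing_sum qs (\<pi> x) (\<pi> y) (\<pi> z) (\<pi> w))"
    and "E = (\<lambda>x y z w. pairing_sum rs (\<pi> x) (\<pi> y) (\<pi> z) (\<pi> w))"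
  have C: "tensor (bv.span T) (length ps) C" and D: "tensor (bv.span T) (length qs) D"
    and E: "tensor (bv.span T) (length rs) E"
    unfolding C_def D_def E_def by (rule tensor_pullback[OF sub(1) pb] tensor_pullback[OF sub(2) pb] tensor_pullback[OF sub(3) pb]; assumption)+
  \<comment> \<open>All forms in \<open>ls\<close> vanish on the range of \<open>\<sigma>\<close>,
    so after the pullback the decomposition holds for all arguments.\<close>
  have rho1: "a1 x y z w + a1 x y w z = C x y z w + D x z y w + E x w y z" for x y z w
    using dec \<sigma>(2) unfolding pairing_decomposition_def a1_def C_def D_def E_def by (simp add: \<pi>_def)
  have a1_sym: "a1 x y z w = a1 y x z w" "a1 x y z w = a1 x z y w" "a1 x x z w = 0" for x y z w
    unfolding a1_def by (rule sym12, rule sym23, rule alt)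
  have small: "3 * (length ps + length qs + length rs) \<le> 4 * r"
    using len by simp
  note rel = pairing_relations[OF a1_sym C D E small rho1]
  have cardT: "card T \<le> 4 * r"
    using T(2) cardS by simp
  from symmetric_correction[OF D T(1) refl cardT rel(2,4,5)]
  obtain w where w: "quadrilinear w" "partition_sum (3 * (card T)\<^sup>2) w" and
    "\<forall>x y z u. w x y z u = w y x z u \<and> w x y z u = w x z y u \<and>
      w x y z u + w x y u z = D x y z u + D x y u z + D x z y u + D x u y z"
    by blast
  then have w_sym: "w x y z u = w y x z u" "w x y z u = w x z y u"
    "w x y z u + w x y u z = D x y z u + D x y u z + D x z y u + D x u y z" for x y z u
    by blast+
  have near: "near_id (r + card S * (4 * r)) \<pi>"
    unfolding \<pi>_def by (rule near_id_compose[OF \<sigma>(1) \<tau>])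
  have quad1: "quadrilinear a1"
    using quad near_id_additive[OF near] unfolding quadrilinear_iff a1_def additive_def by simp
  let ?a = "\<lambda>x y z u. a1 x y z u + w x y z u"
  have "?a x y z u = ?a x y u z" for x y z u
  proof -
    have "?a x y z u + ?a x y u z = (a1 x y z u + a1 x y u z) + (w x y z u + w x y u z)"
      by (simp add: add_ac)
    also have "\<dots> = 0"
      unfolding rho1 w_sym(3) by (simp add: rel(1,3) add_ac)
    finally show ?thesis by (simp add: add_eq_0_iff_eq)
  qed
  moreover have "?a x y z u = ?a y x z u" for x y z u
    by (simp only: a1_sym(1)[of x y] w_sym(1)[of x y])
  moreover have "?a x y z u = ?a x z y u" for x y z u
    by (simp only: a1_sym(2)[of x y] w_sym(2)[of x y])
  moreover have "quadrilinear ?a"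
    using quad1 w(1) unfolding quadrilinear_iff by (simp add: add_ac)
  moreover have "partition_sum (4 * r + 112 * r\<^sup>2) (\<lambda>x y z u. a x y z u + ?a x y z u)"
  proof -
    have "partition_sum (4 * (r + card S * (4 * r)) + 3 * (card T)\<^sup>2)
        (\<lambda>x y z u. (a x y z u + a1 x y z u) + w x y z u)"
      using partition_sum_near_id[OF quad near] w(2) unfolding a1_def by (rule partition_sum_add)
    moreover have "4 * (r + card S * (4 * r)) + 3 * (card T)\<^sup>2 \<le> 4 * r + 112 * r\<^sup>2"
    proof -
      have "card S * (4 * r) \<le> 16 * r\<^sup>2"
        using mult_le_mono1[OF cardS, of "4 * r"] by (simp add: power2_eq_square)
      moreover have "(card T)\<^sup>2 \<le> 16 * r\<^sup>2"
        using power_mono[of "card T" "4 * r" 2] T(2) cardS by (simp add: power_mult_distrib)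
      ultimately show ?thesis by (simp add: algebra_simps)
    qed
    ultimately show ?thesis
      by (simp add: partition_sum_mono add.assoc)
  qed
  ultimately show ?thesis by blast
qed

section \<open>Transfer between tuples of vectors and curried forms\<close>

text \<open>The type \<^typ>\<open>nat \<Rightarrow> bit\<close> replaces \<^term>\<open>carrier_vec n\<close>: its addition is total, and
  \<^term>\<open>vec n\<close> and \<open>entries\<close> (padding by zeros) are additive maps between the two.\<close>

definition entries :: "bit vec \<Rightarrow> nat \<Rightarrow> bit" where
  "entries v j = (if j < dim_vec v then v $ j else 0)"

definition point :: "nat \<Rightarrow> (nat \<Rightarrow> nat \<Rightarrow> bit) \<Rightarrow> nat \<Rightarrow> bit vec" where
  "point n q = (\<lambda>i\<in>{1..4}. vec n (q i))"

definition four :: "'v \<Rightarrow> 'v \<Rightarrow> 'v \<Rightarrow> 'v \<Rightarrow> nat \<Rightarrow> 'v" where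
  "four x y z w i = (if i = 1 then x else if i = 2 then y else if i = 3 then z else w)"

definition curried :: "nat \<Rightarrow> ((nat \<Rightarrow> bit vec) \<Rightarrow> bit) \<Rightarrow> (nat \<Rightarrow> bit) form" where
  "curried n \<alpha> x y z w = \<alpha> (point n (four x y z w))"

definition uncurried :: "(nat \<Rightarrow> bit) form \<Rightarrow> (nat \<Rightarrow> bit vec) \<Rightarrow> bit" where
  "uncurried f x = f (entries (x 1)) (entries (x 2)) (entries (x 3)) (entries (x 4))"

lemma interval_1_4_cases: "i \<in> {1..4::nat} \<Longrightarrow> i = 1 \<or> i = 2 \<or> i = 3 \<or> i = 4"
  by auto

lemma entries_add: "u \<in> carrier_vec n \<Longrightarrow> v \<in> carrier_vec n \<Longrightarrow> entries (u + v) = entries u + entries v"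
  by (auto simp: entries_def fun_eq_iff)

lemma entries_smult: "entries (c \<cdot>\<^sub>v v) = bscale c (entries v)"
  by (auto simp: entries_def fun_eq_iff bscale_fun)

lemma vec_entries: "v \<in> carrier_vec n \<Longrightarrow> vec n (entries v) = v"
  by (intro eq_vecI) (auto simp: entries_def)

lemma vec_plus: "vec n (f + g) = vec n f + vec n (g :: nat \<Rightarrow> bit)"
  by (intro eq_vecI) auto

lemma point_in_tuples: "point n q \<in> tuples n {1..4}"
  by (simp add: point_def tuples_def)

lemma point_entries:
  assumes "x \<in> tuples n {1..4}"
  shows "point n (four (entries (x 1)) (entries (x 2)) (entries (x 3)) (entries (x 4))) = x"
proof
  fix i
  show "point n (four (entries (x 1)) (entries (x 2)) (entries (x 3)) (entries (x 4))) i = x i"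
  proof (cases "i \<in> {1..4}")
    case True
    then have "x i \<in> carrier_vec n"
      using assms by (auto simp: tuples_def)
    then show ?thesis
      using True interval_1_4_cases[OF True] by (auto simp: point_def four_def vec_entries)
  next
    case False
    moreover have "x i = undefined"
      using assms False by (auto simp: tuples_def PiE_iff extensional_def)
    ultimately show ?thesis by (simp only: point_def restrict_apply if_False)
  qed
qed

lemma uncurried_curried: "x \<in> tuples n {1..4} \<Longrightarrow> uncurried (curried n \<alpha>) x = \<alpha> x"
  by (simp only: uncurried_def curried_def point_entries)

lemma point_four_upd:
  "point n (four x' y z w) = (point n (four x y z w))(1 := vec n x')"
  "point n (four x y' z w) = (point n (four x y z w))(2 := vec n y')"
  "point n (four x y z' w) = (point n (four x y z w))(3 := vec n z')"
  "point n (four x y z w') = (point n (four x y z w))(4 := vec n w')"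
  by (auto simp: point_def fun_eq_iff four_def)

lemma varies_in_restrict:
  assumes ml: "multilinear_form n I \<beta>" and I: "I \<subseteq> {1..4}" and k: "k \<in> {1..4}"
  shows "varies_in (k \<in> I) (\<lambda>v. \<beta> (restrict ((point n q)(k := vec n v)) I))"
proof (cases "k \<in> I")
  case True
  have t: "restrict (point n q) I \<in> tuples n I"
    using point_in_tuples[of n q] I by (auto simp: tuples_def)
  have "restrict ((point n q)(k := u)) I = (restrict (point n q) I)(k := u)" for u
    using True by (auto simp: fun_eq_iff)
  then show ?thesis
    using ml t True unfolding varies_in_def additive_def multilinear_form_def by (simp add: vec_plus)
next
  case False
  then have "restrict ((point n q)(k := u)) I = restrict (point n q) I" for u
    by (auto simp: fun_eq_iff)
  then show ?thesis using False by (simp add: varies_in_def)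
qed

lemma form_on_restrict:
  assumes "multilinear_form n I \<beta>" "I \<subseteq> {1..4}"
  shows "form_on I (curried n (\<lambda>x. \<beta> (restrict x I)))"
  unfolding form_on_def curried_def
proof (intro allI conjI)
  fix x y z w :: "nat \<Rightarrow> bit"
  note v = varies_in_restrict[OF assms, where q = "four 0 y z w"] varies_in_restrict[OF assms, where q = "four x 0 z w"]
    varies_in_restrict[OF assms, where q = "four x y 0 w"] varies_in_restrict[OF assms, where q = "four x y z 0"]
  show "varies_in (1 \<in> I) (\<lambda>x. \<beta> (restrict (point n (four x y z w)) I))"
    using v(1)[of 1] by (subst point_four_upd(1)[of n _ y z w 0]) simp
  show "varies_in (2 \<in> I) (\<lambda>y. \<beta> (restrict (point n (four x y z w)) I))"
    using v(2)[of 2] by (subst point_four_upd(2)[of n x _ z w 0]) simp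
  show "varies_in (3 \<in> I) (\<lambda>z. \<beta> (restrict (point n (four x y z w)) I))"
    using v(3)[of 3] by (subst point_four_upd(3)[of n x y _ w 0]) simp
  show "varies_in (4 \<in> I) (\<lambda>w. \<beta> (restrict (point n (four x y z w)) I))"
    using v(4)[of 4] by (subst point_four_upd(4)[of n x y z _ 0]) simp
qed

lemma quadrilinear_curried:
  assumes "multilinear_form n {1..4} \<alpha>"
  shows "quadrilinear (curried n \<alpha>)"
proof -
  have "restrict (point n q) {1..4} = point n q" for q
    by (auto simp: point_def fun_eq_iff)
  then have "curried n (\<lambda>x. \<alpha> (restrict x {1..4})) = curried n \<alpha>"
    unfolding curried_def by (simp only:)
  then show ?thesis using form_on_restrict[OF assms order_refl] by (simp only:)
qed

lemma multilinear_uncurried: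
  assumes f: "form_on I f" and I: "I \<subseteq> {1..4}"
  shows "multilinear_form n I (uncurried f)"
  unfolding multilinear_form_def
proof (intro ballI)
  fix x i assume x: "x \<in> tuples n I" and i: "i \<in> I"
  define g where "g v = uncurried f (x(i := v))" for v
  have "\<exists>h. additive h \<and> (\<forall>v. g v = h (entries v))"
  proof -
    have "i = 1 \<or> i = 2 \<or> i = 3 \<or> i = 4"
      using i I interval_1_4_cases by blast
    then show ?thesis
      unfolding g_def uncurried_def using i
      by (elim disjE) (auto intro!: exI conjI form_on_additive[OF f])
  qed
  then obtain h where h: "additive h" "\<And>v. g v = h (entries v)" by blast
  then show "(\<forall>u\<in>carrier_vec n. \<forall>v\<in>carrier_vec n.
        uncurried f (x(i := u + v)) = uncurried f (x(i := u)) + uncurried f (x(i := v))) \<and>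
      (\<forall>c. \<forall>v\<in>carrier_vec n. uncurried f (x(i := c \<cdot>\<^sub>v v)) = c * uncurried f (x(i := v)))"
    unfolding g_def[symmetric] by (auto simp: entries_add entries_smult additive_bscale additive.add)
qed

text \<open>Restriction replaces the coordinates outside \<open>I\<close> by
  \<open>undefined\<close>, and \<open>f\<close> is constant in exactly those.\<close>

lemma uncurried_restrict:
  assumes "form_on I f"
  shows "uncurried f (restrict x I) = uncurried f x"
proof -
  note c = form_on_const[OF assms]
  have "f (entries (restrict x I 1)) y z w = f (entries (x 1)) y z w"
    "f y (entries (restrict x I 2)) z w = f y (entries (x 2)) z w"
    "f y z (entries (restrict x I 3)) w = f y z (entries (x 3)) w"
    "f y z w (entries (restrict x I 4)) = f y z w (entries (x 4))" for y z w
    using c(1)[of "entries (restrict x I 1)" y z w] c(1)[of "entries (x 1)" y z w]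
      c(2)[of y "entries (restrict x I 2)" z w] c(2)[of y "entries (x 2)" z w]
      c(3)[of y z "entries (restrict x I 3)" w] c(3)[of y z "entries (x 3)" w]
      c(4)[of y z w "entries (restrict x I 4)"] c(4)[of y z w "entries (x 4)"]
    by (metis restrict_apply')+
  then show ?thesis
    unfolding uncurried_def by (simp only:)
qed

lemma partition_sum_curried:
  assumes "partition_decomposition n 4 \<alpha> m"
  shows "partition_sum m (curried n \<alpha>)"
proof -
  obtain I \<beta> \<gamma> where dec: "\<forall>i\<in>{1..m}. I i \<noteq> {} \<and> I i \<subset> {1..4} \<and>
      multilinear_form n (I i) (\<beta> i) \<and> multilinear_form n ({1..4} - I i) (\<gamma> i)"
    and eq: "\<forall>x\<in>tuples n {1..4}.
      \<alpha> x = (\<Sum>i = 1..m. \<beta> i (restrict x (I i)) * \<gamma> i (restrict x ({1..4} - I i)))"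
    using assms unfolding partition_decomposition_def by blast
  define t where "t i x y z w = curried n (\<lambda>x. \<beta> i (restrict x (I i))) x y z w
      * curried n (\<lambda>x. \<gamma> i (restrict x ({1..4} - I i))) x y z w" for i x y z w
  have "k \<le> m \<Longrightarrow> partition_sum k (\<lambda>x y z w. \<Sum>i = 1..k. t i x y z w)" for k
  proof (induction k)
    case 0
    then show ?case using partition_sum_0 by simp
  next
    case (Suc k)
    have mem: "Suc k \<in> {1..m}" and "k \<le> m" using Suc.prems by simp_all
    from bspec[OF dec mem] obtain i j where ij: "i \<in> I (Suc k)" "j \<in> {1..4} - I (Suc k)" "I (Suc k) \<subseteq> {1..4}"
      by blast
    have forms: "form_on (I (Suc k)) (curried n (\<lambda>x. \<beta> (Suc k) (restrict x (I (Suc k)))))"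
      "form_on ({1..4} - I (Suc k)) (curried n (\<lambda>x. \<gamma> (Suc k) (restrict x ({1..4} - I (Suc k)))))"
      using bspec[OF dec mem] by (auto intro!: form_on_restrict simp del: One_nat_def)
    from partition_sum_Suc[OF Suc.IH[OF \<open>k \<le> m\<close>] ij forms]
    have "partition_sum (Suc k) (\<lambda>x y z w. (\<Sum>i = 1..k. t i x y z w) + t (Suc k) x y z w)"
      unfolding t_def .
    then show ?case by simp
  qed
  moreover have "curried n \<alpha> = (\<lambda>x y z w. \<Sum>i = 1..m. t i x y z w)"
    unfolding curried_def t_def bspec[OF eq point_in_tuples] ..
  ultimately show ?thesis by simp
qed

lemma partition_decomposition_uncurried:
  "partition_sum m f \<Longrightarrow> partition_decomposition n 4 (uncurried f) m"
proof (induction rule: partition_sum.induct)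
  case partition_sum_0
  then show ?case by (simp add: partition_decomposition_def uncurried_def)
next
  case (partition_sum_Suc m f i J j b c)
  then obtain I \<beta> \<gamma> where dec: "\<forall>i\<in>{1..m}. I i \<noteq> {} \<and> I i \<subset> {1..4} \<and>
      multilinear_form n (I i) (\<beta> i) \<and> multilinear_form n ({1..4} - I i) (\<gamma> i)"
    and eq: "\<forall>x\<in>tuples n {1..4}.
      uncurried f x = (\<Sum>i = 1..m. \<beta> i (restrict x (I i)) * \<gamma> i (restrict x ({1..4} - I i)))"
    unfolding partition_decomposition_def by blast
  have J: "J \<noteq> {}" "J \<subset> {1..4}"
    using partition_sum_Suc.hyps(2-4) by blast+
  have ml: "multilinear_form n J (uncurried b)" "multilinear_form n ({1..4} - J) (uncurried c)"
    using multilinear_uncurried partition_sum_Suc.hyps by blast+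
  let ?I = "I(Suc m := J)" and ?b = "\<beta>(Suc m := uncurried b)" and ?c = "\<gamma>(Suc m := uncurried c)"
  have "\<forall>i\<in>{1..Suc m}. ?I i \<noteq> {} \<and> ?I i \<subset> {1..4} \<and>
      multilinear_form n (?I i) (?b i) \<and> multilinear_form n ({1..4} - ?I i) (?c i)"
    using dec J ml by simp
  moreover have "\<forall>x\<in>tuples n {1..4}. uncurried (\<lambda>x y z w. f x y z w + b x y z w * c x y z w) x
      = (\<Sum>i = 1..Suc m. ?b i (restrict x (?I i)) * ?c i (restrict x ({1..4} - ?I i)))"
  proof
    fix x assume x: "x \<in> tuples n {1..4}"
    have "(\<Sum>i = 1..Suc m. ?b i (restrict x (?I i)) * ?c i (restrict x ({1..4} - ?I i)))
        = (\<Sum>i = 1..m. \<beta> i (restrict x (I i)) * \<gamma> i (restrict x ({1..4} - I i)))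
          + uncurried b (restrict x J) * uncurried c (restrict x ({1..4} - J))"
      by simp
    also have "\<dots> = uncurried f x + uncurried b x * uncurried c x"
      unfolding bspec[OF eq x, symmetric] using partition_sum_Suc.hyps(5,6) by (simp only: uncurried_restrict)
    finally show "uncurried (\<lambda>x y z w. f x y z w + b x y z w * c x y z w) x
        = (\<Sum>i = 1..Suc m. ?b i (restrict x (?I i)) * ?c i (restrict x ({1..4} - ?I i)))"
      by (simp only: uncurried_def)
  qed
  ultimately show ?case
    unfolding partition_decomposition_def by (intro exI[of _ ?I] exI[of _ ?b] exI[of _ ?c] conjI)
qed

section \<open>Coordinate permutations, the numerical bound and the theorem on tuples\<close>

lemma partition_decomposition_cong:
  assumes "\<And>x. x \<in> tuples n {1..k} \<Longrightarrow> \<alpha> x = \<beta> x"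
  shows "partition_decomposition n k \<alpha> m \<longleftrightarrow> partition_decomposition n k \<beta> m"
  using assms unfolding partition_decomposition_def by (simp cong: ball_cong)

lemma symmetric_form_uncurried:
  assumes "\<And>x y z w. f x y z w = f y x z w" "\<And>x y z w. f x y z w = f x z y w" "\<And>x y z w. f x y z w = f x y w z"
  shows "symmetric_form n 4 (uncurried f)"
  unfolding symmetric_form_def symmetric_in_def permute_form_def
proof (intro allI impI ballI)
  fix \<pi> :: "nat \<Rightarrow> nat" and x assume \<pi>: "\<pi> permutes {1..4}"
  have "\<pi> k = 1 \<or> \<pi> k = 2 \<or> \<pi> k = 3 \<or> \<pi> k = 4" if "k \<in> {1..4}" for k
    using permutes_in_image[OF \<pi>, of k] that interval_1_4_cases[of "\<pi> k"] by simp
  from this[of 1] this[of 2] this[of 3] this[of 4]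
  have r: "\<pi> 1 = 1 \<or> \<pi> 1 = 2 \<or> \<pi> 1 = 3 \<or> \<pi> 1 = 4" "\<pi> 2 = 1 \<or> \<pi> 2 = 2 \<or> \<pi> 2 = 3 \<or> \<pi> 2 = 4"
    "\<pi> 3 = 1 \<or> \<pi> 3 = 2 \<or> \<pi> 3 = 3 \<or> \<pi> 3 = 4" "\<pi> 4 = 1 \<or> \<pi> 4 = 2 \<or> \<pi> 4 = 3 \<or> \<pi> 4 = 4"
    by simp_all
  have inj: "\<pi> i = \<pi> j \<longleftrightarrow> i = j" for i j
    using permutes_inj[OF \<pi>] by (simp add: inj_eq)
  have ne: "\<pi> 1 \<noteq> \<pi> 2" "\<pi> 1 \<noteq> \<pi> 3" "\<pi> 1 \<noteq> \<pi> 4" "\<pi> 2 \<noteq> \<pi> 3" "\<pi> 2 \<noteq> \<pi> 4" "\<pi> 3 \<noteq> \<pi> 4"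
    unfolding inj by simp_all
  \<comment> \<open>All 24 permutations are treated by cases; the three adjacent exchanges act as
    ordered rewrite rules that sort the arguments.\<close>
  show "uncurried f (x \<circ> \<pi>) = uncurried f x"
    unfolding uncurried_def o_def using r ne
    by (elim disjE) (simp_all add: assms)
qed

lemma curried_swap:
  "curried n (permute_form (transpose 1 2) \<alpha>) x y z w = curried n \<alpha> y x z w"
  "curried n (permute_form (transpose 2 3) \<alpha>) x y z w = curried n \<alpha> x z y w"
  "curried n (permute_form (transpose 3 4) \<alpha>) x y z w = curried n \<alpha> x y w z"
proof -
  have "point n (four x y z w) \<circ> transpose 1 2 = point n (four y x z w)"
    "point n (four x y z w) \<circ> transpose 2 3 = point n (four x z y w)"
    "point n (four x y z w) \<circ> transpose 3 4 = point n (four x y w z)"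
    by (auto simp: fun_eq_iff point_def four_def Transposition.transpose_def)
  then show "curried n (permute_form (transpose 1 2) \<alpha>) x y z w = curried n \<alpha> y x z w"
    "curried n (permute_form (transpose 2 3) \<alpha>) x y z w = curried n \<alpha> x z y w"
    "curried n (permute_form (transpose 3 4) \<alpha>) x y z w = curried n \<alpha> x y w z"
    by (simp_all only: curried_def permute_form_def)
qed

text \<open>For natural \<open>r\<close> the left side is at most \<open>116 * r\<^sup>2\<close>,
  which is below \<open>(11 * r)\<^sup>2\<close>; squaring \<open>11 * r \<le> exp (11 * r)\<close>
  produces the constant 22.\<close>

lemma double_exp_bound: "4 * real r + 112 * (real r)\<^sup>2 \<le> exp (exp (22 * real r))"
proof -
  have "real r \<le> (real r)\<^sup>2"
    by (cases r) (simp_all add: power2_eq_square)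
  moreover have "(11 * real r)\<^sup>2 = 121 * (real r)\<^sup>2"
    by (simp add: power_mult_distrib)
  ultimately have "4 * real r + 112 * (real r)\<^sup>2 \<le> (11 * real r)\<^sup>2"
    using zero_le_power2[of "real r"] by linarith
  also have "\<dots> \<le> (exp (11 * real r))\<^sup>2"
    using exp_ge_add_one_self[of "11 * real r"] by (intro power_mono) linarith+
  also have "\<dots> = exp (22 * real r)"
    by (simp flip: exp_double)
  also have "\<dots> \<le> exp (exp (22 * real r))"
    using exp_ge_add_one_self[of "22 * real r"] unfolding exp_le_cancel_iff by linarith
  finally show ?thesis .
qed

theorem theorem8:
  shows "\<exists>A::real. A > 0 \<and>
    (\<forall>(n::nat) (r::nat) (\<alpha> :: (nat \<Rightarrow> bit vec) \<Rightarrow> bit).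
       r > 0 \<longrightarrow>
       multilinear_form n {1..4} \<alpha> \<longrightarrow>
       symmetric_in n 4 {1..3} \<alpha> \<longrightarrow>
       (\<forall>x\<in>tuples n {1..4}. x 1 = x 2 \<longrightarrow> \<alpha> x = 0) \<longrightarrow>
       prank n 4 (\<lambda>x. \<alpha> x + permute_form (transpose 3 4) \<alpha> x) \<le> r \<longrightarrow>
       (\<exists>\<alpha>'. multilinear_form n {1..4} \<alpha>' \<and> symmetric_form n 4 \<alpha>' \<and>
          real (prank n 4 (\<lambda>x. \<alpha> x + \<alpha>' x)) \<le> exp (exp (A * real r))))"
proof (intro exI[of _ "22::real"] conjI allI impI)
  fix n r :: nat and \<alpha> :: "(nat \<Rightarrow> bit vec) \<Rightarrow> bit"
  assume ml: "multilinear_form n {1..4} \<alpha>" and sym: "symmetric_in n 4 {1..3} \<alpha>"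
    and alt: "\<forall>x\<in>tuples n {1..4}. x 1 = x 2 \<longrightarrow> \<alpha> x = 0"
    and rank: "prank n 4 (\<lambda>x. \<alpha> x + permute_form (transpose 3 4) \<alpha> x) \<le> r"
  let ?\<rho> = "\<lambda>x. \<alpha> x + permute_form (transpose 3 4) \<alpha> x"
  define a where "a = curried n \<alpha>"
  have quad: "quadrilinear a"
    unfolding a_def using ml by (rule quadrilinear_curried)
  have swap: "curried n (permute_form \<pi> \<alpha>) x y z w = a x y z w" if "\<pi> permutes {1..3}" for \<pi> x y z w
    using sym that point_in_tuples unfolding symmetric_in_def a_def curried_def by blast
  have sym12: "a x y z w = a y x z w" and sym23: "a x y z w = a x z y w" for x y z w
    using swap[OF permutes_swap_id[of 1 "{1..3}" 2], of x y z w] swap[OF permutes_swap_id[of 2 "{1..3}" 3], of x y z w]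
    unfolding curried_swap a_def by simp_all
  have a_alt: "a x x z w = 0" for x z w
  proof -
    have "point n (four x x z w) 1 = point n (four x x z w) 2"
      by (simp add: point_def four_def)
    then show ?thesis
      using alt point_in_tuples unfolding a_def curried_def by blast
  qed
  have rho_curried: "curried n ?\<rho> = (\<lambda>x y z w. a x y z w + a x y w z)"
  proof (intro ext)
    fix x y z w
    show "curried n ?\<rho> x y z w = a x y z w + a x y w z"
      using curried_swap(3)[of n \<alpha> x y z w] unfolding a_def curried_def by simp
  qed
  \<comment> \<open>Since \<open>prank\<close> is a \<open>LEAST\<close>, the rank hypothesis yields
    a decomposition only once some decomposition is known to exist. Multilinearity for that is
    obtained on the curried side and carried back.\<close>
  have "quadrilinear (\<lambda>x y z w. a x y z w + a x y w z)"
    using quad unfolding quadrilinear_iff by (simp add: add_ac)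
  then have "multilinear_form n {1..4} (uncurried (curried n ?\<rho>))"
    unfolding rho_curried by (rule multilinear_uncurried) simp
  then obtain m where "partition_decomposition n 4 (uncurried (curried n ?\<rho>)) m"
    using partition_decomposition_exists[of 4 n] by auto
  then have "partition_decomposition n 4 ?\<rho> m"
    using partition_decomposition_cong[of n 4 "uncurried (curried n ?\<rho>)" ?\<rho>, OF uncurried_curried] by blast
  then have "partition_decomposition n 4 ?\<rho> (prank n 4 ?\<rho>)"
    unfolding prank_def by (rule LeastI)
  from partition_sum_mono[OF partition_sum_curried[OF this] rank]
  have "partition_sum r (\<lambda>x y z w. a x y z w + a x y w z)"
    unfolding rho_curried .
  from symmetrization[OF quad sym12 sym23 a_alt this]
  obtain a' where quad': "quadrilinear a'"
    and sym': "\<forall>x y z w. a' x y z w = a' y x z w \<and> a' x y z w = a' x z y w \<and> a' x y z w = a' x y w z"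
    and part: "partition_sum (4 * r + 112 * r\<^sup>2) (\<lambda>x y z w. a x y z w + a' x y z w)"
    by blast
  show "\<exists>\<alpha>'. multilinear_form n {1..4} \<alpha>' \<and> symmetric_form n 4 \<alpha>' \<and>
      real (prank n 4 (\<lambda>x. \<alpha> x + \<alpha>' x)) \<le> exp (exp (22 * real r))"
  proof (intro exI[of _ "uncurried a'"] conjI)
    show "multilinear_form n {1..4} (uncurried a')"
      using quad' by (rule multilinear_uncurried) simp
    show "symmetric_form n 4 (uncurried a')"
      using sym' by (intro symmetric_form_uncurried) blast+
    have "uncurried (\<lambda>x y z w. a x y z w + a' x y z w) x = \<alpha> x + uncurried a' x" if "x \<in> tuples n {1..4}" for x
      using uncurried_curried[OF that, of \<alpha>] by (simp add: uncurried_def a_def)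
    then have "partition_decomposition n 4 (\<lambda>x. \<alpha> x + uncurried a' x) (4 * r + 112 * r\<^sup>2)"
      using partition_decomposition_uncurried[OF part, of n]
      by (subst (asm) partition_decomposition_cong) auto
    then have "prank n 4 (\<lambda>x. \<alpha> x + uncurried a' x) \<le> 4 * r + 112 * r\<^sup>2"
      unfolding prank_def by (rule Least_le)
    then have "real (prank n 4 (\<lambda>x. \<alpha> x + uncurried a' x)) \<le> real (4 * r + 112 * r\<^sup>2)"
      by (rule of_nat_mono)
    also have "\<dots> \<le> exp (exp (22 * real r))"
      using double_exp_bound[of r] by simp
    finally show "real (prank n 4 (\<lambda>x. \<alpha> x + uncurried a' x)) \<le> exp (exp (22 * real r))" .
  qed
qed simp

end
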